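(* Let $0<r<1$, $\frac12<\beta<1$, $a_1,a_2>0$ and $b_2>b_1>0$, and set $$\Omega_n=\left\{(\varepsilon_n,\mu_n): b_1n^{-\beta}\le\varepsilon_n\le b_2n^{-\beta},\ \sqrt{2r\log n}-\frac{a_1}{\log n}\le\mu_n\le\sqrt{2r\log n}+\frac{a_2}{\log n}\right\}.$$ Let $X_1,\dots,X_n$ be i.i.d. from $(1-\varepsilon_n)N(0,1)+\varepsilon_nN(\mu_n,1)$. Let $0<\alpha<\frac12$ and let the infimum below range over all $(1-\alpha)$ level lower confidence limits $\hat\varepsilon_n$ for $\varepsilon_n$ over $\Omega_n$, that is, over all measurable functions $\hat\varepsilon_n$ of $X_1,\dots,X_n$ with $\inf_{(\varepsilon_n,\mu_n)\in\Omega_n}P\{\varepsilon_n\ge\hat\varepsilon_n\}\ge1-\alpha$. Then there is a constant $C>0$ not depending on $n$ such that, for all sufficiently large $n$, $$\inf_{\hat\varepsilon_n}\sup_{(\varepsilon_n,\mu_n)\in\Omega_n}E\left(1-\frac{\hat\varepsilon_n}{\varepsilon_n}\right)_+\ge\begin{cases}C(\log n)^{1/2}\,n^{-1/2-r+\beta}, & \text{when }\beta\ge3r,\\ C(\log n)^{5/4}\,n^{-1/2+(\beta+r)^2/(8r)}, & \text{when }r<\beta<3r,\\ C\,n^{-1/2+\beta/2}, & \text{when }\beta\le r.\end{cases}$$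
   Context: $(1-\varepsilon)N(0,1)+\varepsilon N(\mu,1)$ denotes the mixture distribution with weights $1-\varepsilon$ and $\varepsilon$ of the normal laws with means $0$ and $\mu$ and variance $1$. Probabilities and expectations are under the law with parameters $(\varepsilon_n,\mu_n)$. $x_+=\max(x,0)$, and $\log$ is the natural logarithm.
   Formalization: Added: r > β−1/2 if β ≤ 3/4, r > (1−√(1−β))² if β > 3/4. Elsewhere the claim fails: the stated rate is unbounded (e.g. r=1/10, β=9/10), while the valid confidence limit 0 has risk 1. *)

theory Defs
  imports "HOL-Probability.Probability"
begin

definition mixture :: "real \<Rightarrow> real \<Rightarrow> real measure" where
  "mixture \<epsilon> \<mu> =
     density lborel (\<lambda>x. ennreal ((1 - \<epsilon>) * normal_density 0 1 x + \<epsilon> * normal_density \<mu> 1 x))"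

text \<open>The joint law of \<open>X\<^sub>1, \<dots>, X\<^sub>n\<close>.\<close>

definition sample_law :: "nat \<Rightarrow> real \<Rightarrow> real \<Rightarrow> (nat \<Rightarrow> real) measure" where
  "sample_law n \<epsilon> \<mu> = PiM {1..n} (\<lambda>_. mixture \<epsilon> \<mu>)"

definition Omega ::
    "real \<Rightarrow> real \<Rightarrow> real \<Rightarrow> real \<Rightarrow> real \<Rightarrow> real \<Rightarrow> nat \<Rightarrow> (real \<times> real) set" where
  "Omega r \<beta> a\<^sub>1 a\<^sub>2 b\<^sub>1 b\<^sub>2 n =
     {(\<epsilon>, \<mu>). b\<^sub>1 * real n powr (-\<beta>) \<le> \<epsilon> \<and> \<epsilon> \<le> b\<^sub>2 * real n powr (-\<beta>) \<and>
        sqrt (2 * r * ln (real n)) - a\<^sub>1 / ln (real n) \<le> \<mu> \<and>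
        \<mu> \<le> sqrt (2 * r * ln (real n)) + a\<^sub>2 / ln (real n)}"

definition lower_confidence_limit ::
    "nat \<Rightarrow> (real \<times> real) set \<Rightarrow> real \<Rightarrow> ((nat \<Rightarrow> real) \<Rightarrow> real) \<Rightarrow> bool" where
  "lower_confidence_limit n \<Omega> \<alpha> est \<longleftrightarrow>
     est \<in> borel_measurable (PiM {1..n} (\<lambda>_. borel)) \<and>
     (INF (\<epsilon>, \<mu>)\<in>\<Omega>.
        measure (sample_law n \<epsilon> \<mu>) {x \<in> space (sample_law n \<epsilon> \<mu>). \<epsilon> \<ge> est x}) \<ge> 1 - \<alpha>"

text \<open>Valued in the extended nonnegative reals, because a confidence limit that is not bounded
  below may have infinite risk.\<close>

definition risk :: "nat \<Rightarrow> ((nat \<Rightarrow> real) \<Rightarrow> real) \<Rightarrow> real \<Rightarrow> real \<Rightarrow> ennreal" where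
  "risk n est \<epsilon> \<mu> = (\<integral>\<^sup>+x. ennreal (max (1 - est x / \<epsilon>) 0) \<partial>sample_law n \<epsilon> \<mu>)"

definition minimax_risk :: "nat \<Rightarrow> (real \<times> real) set \<Rightarrow> real \<Rightarrow> ennreal" where
  "minimax_risk n \<Omega> \<alpha> =
     (INF est \<in> {est. lower_confidence_limit n \<Omega> \<alpha> est}. SUP (\<epsilon>, \<mu>)\<in>\<Omega>. risk n est \<epsilon> \<mu>)"

definition rate :: "real \<Rightarrow> real \<Rightarrow> nat \<Rightarrow> real" where
  "rate r \<beta> n =
     (if \<beta> \<ge> 3 * r then ln (real n) powr (1/2) * real n powr (- 1/2 - r + \<beta>)
      else if r < \<beta> \<and> \<beta> < 3 * r
        then ln (real n) powr (5/4) * real n powr (- 1/2 + (\<beta> + r)\<^sup>2 / (8 * r))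
      else real n powr (- 1/2 + \<beta> / 2))"

text \<open>The detection boundary for sparse normal mixtures, \<open>r > detection_boundary \<beta>\<close> being the
  estimable region. For \<open>r \<le> detection_boundary \<beta>\<close> the quantity \<^term>\<open>rate r \<beta> n\<close> tends to
  infinity, whereas the trivial confidence limit \<open>0\<close> has risk 1.\<close>

definition detection_boundary :: "real \<Rightarrow> real" where
  "detection_boundary \<beta> = (if \<beta> \<le> 3/4 then \<beta> - 1/2 else (1 - sqrt (1 - \<beta>))\<^sup>2)"

end

theory Submission
  imports Defs "HOL-Real_Asymp.Real_Asymp"
begin

text \<open>
  A lower confidence limit that is valid at \<open>(\<epsilon>\<^sub>0, \<mu>\<^sub>0)\<close> is at most \<open>\<epsilon>\<^sub>0\<close> there with probability at least
  \<open>1 - \<alpha>\<close>. If a pair \<open>(\<epsilon>\<^sub>1, \<mu>\<^sub>1)\<close> with \<open>\<epsilon>\<^sub>1 > \<epsilon>\<^sub>0\<close> cannot be told apart from \<open>(\<epsilon>\<^sub>0, \<mu>\<^sub>0)\<close> on the basis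
  of \<open>n\<close> observations, the limit is at most \<open>\<epsilon>\<^sub>0\<close> with substantial probability under \<open>(\<epsilon>\<^sub>1, \<mu>\<^sub>1)\<close> as
  well, and on that event it loses at least \<open>1 - \<epsilon>\<^sub>0 / \<epsilon>\<^sub>1\<close>. The lower bound is thus the relative gap
  between \<open>\<epsilon>\<^sub>0\<close> and \<open>\<epsilon>\<^sub>1\<close> for a pair whose chi-square distance is a small multiple of \<open>1 / n\<close>
  (\<open>minimax_risk_two_points\<close>); the task is to make this gap large.

  The gap is widened by moving the mean together with the proportion. For \<open>\<epsilon>\<^sub>1 = \<epsilon>\<^sub>0 exp v\<close> and
  \<open>\<mu>\<^sub>1 = \<mu>\<^sub>0 - \<eta>\<close> with \<open>v = \<eta> (A + \<eta> / 2)\<close>, the ratio of the two contaminating components at \<open>x\<close> is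
  \<open>exp (- \<eta> (x - \<mu>\<^sub>0 - A))\<close>: they cross at \<open>\<mu>\<^sub>0 + A\<close>, and nearby they differ by only a relative amount
  \<open>\<eta> |x - \<mu>\<^sub>0 - A|\<close>, although \<open>log (\<epsilon>\<^sub>1 / \<epsilon>\<^sub>0)\<close> is about \<open>\<eta> A\<close>. So the crossing should sit where the
  weight in the chi-square integral is concentrated. Write \<open>\<phi>\<close> for the null density and \<open>p\<close> for the
  component \<open>\<epsilon>\<^sub>0 \<phi>(x - \<mu>\<^sub>0)\<close>; the weight is of the order of \<open>min (p\<^sup>2 / \<phi>) p\<close>. Here \<open>p\<^sup>2 / \<phi>\<close> is a Gaussian
  bump centred at \<open>2 \<mu>\<^sub>0\<close>, \<open>p\<close> is one centred at \<open>\<mu>\<^sub>0\<close>, and \<open>p\<close> overtakes \<open>\<phi>\<close> near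
  \<open>\<mu>\<^sub>0 (\<beta> + r) / (2 r)\<close>, the dominance point. This gives the three cases.

  \<^item> If \<open>\<beta> \<ge> 3 r\<close>, the dominance point is not to the left of \<open>2 \<mu>\<^sub>0\<close>. The crossing is put at \<open>2 \<mu>\<^sub>0\<close>, so
    \<open>A = \<mu>\<^sub>0\<close>, and the distance is of order \<open>\<eta>\<^sup>2 \<epsilon>\<^sub>0\<^sup>2 exp (\<mu>\<^sub>0\<^sup>2)\<close>
    (\<open>component_gap_crossing_at_twice_mean\<close>).

  \<^item> If \<open>r < \<beta> < 3 r\<close>, the dominance point lies strictly between \<open>\<mu>\<^sub>0\<close> and \<open>2 \<mu>\<^sub>0\<close>, and the weight peaks
    there, falling off exponentially on both sides with a rate \<open>\<kappa>\<close> of order \<open>sqrt (log n)\<close>. A crossing at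
    that point replaces the mass \<open>1 / \<kappa>\<close> by the second moment \<open>1 / \<kappa>\<^sup>3\<close>
    (\<open>component_gap_crossing_at_dominance_point\<close>), which, with the factor \<open>A\<close>, is the source of the power \<open>5/4\<close> of \<open>log n\<close>.

  \<^item> If \<open>\<beta> \<le> r\<close>, the component dominates already at its own mean. The mean is kept, and the
    distance is of order \<open>(\<epsilon>\<^sub>1 - \<epsilon>\<^sub>0)\<^sup>2 / \<epsilon>\<^sub>0\<close> (\<open>component_gap_equal_means\<close>).

  Above the detection boundary the powers of \<open>n\<close> in the first two cases are negative
  (\<open>rate_exponent_negative\<close>), and \<open>\<beta> < 1\<close> makes the third one negative. Hence \<open>\<eta>\<close> and \<open>v\<close> vanish fast
  enough for both points to lie in the parameter set.
\<close>

section \<open>Testing two product laws\<close>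

text \<open>The two product measures agree on boxes, where the integral of the product density factorises.\<close>

lemma PiM_density:
  fixes h :: "'a \<Rightarrow> ennreal"
  assumes "prob_space P" and "prob_space (density P h)" and h[measurable]: "h \<in> borel_measurable P"
    and I: "finite I"
  shows "PiM I (\<lambda>_. density P h) = density (PiM I (\<lambda>_. P)) (\<lambda>x. \<Prod>i\<in>I. h (x i))"
proof -
  interpret P: prob_space P by fact
  interpret Q: prob_space "density P h" by fact
  interpret PP: product_prob_space "\<lambda>_. P" I by unfold_locales
  interpret QQ: product_prob_space "\<lambda>_. density P h" I by unfold_locales
  show ?thesis
  proof (rule QQ.PiM_eqI[symmetric])
    show "sets (density (PiM I (\<lambda>_. P)) (\<lambda>x. \<Prod>i\<in>I. h (x i))) = sets (PiM I (\<lambda>_. density P h))"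
      by (simp, rule sets_PiM_cong, auto)
    fix A assume "\<And>i. i \<in> I \<Longrightarrow> A i \<in> sets (density P h)"
    then have A: "i \<in> I \<Longrightarrow> A i \<in> sets P" for i by simp
    have "emeasure (density (PiM I (\<lambda>_. P)) (\<lambda>x. \<Prod>i\<in>I. h (x i))) (Pi\<^sub>E I A)
        = (\<integral>\<^sup>+x. (\<Prod>i\<in>I. h (x i)) * indicator (Pi\<^sub>E I A) x \<partial>PiM I (\<lambda>_. P))"
      using A I by (intro emeasure_density) (auto intro!: sets_PiM_I_finite)
    also have "\<dots> = (\<integral>\<^sup>+x. (\<Prod>i\<in>I. h (x i) * indicator (A i) (x i)) \<partial>PiM I (\<lambda>_. P))"
    proof (rule nn_integral_cong)
      fix x assume "x \<in> space (PiM I (\<lambda>_. P))"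
      then have ext: "x \<in> extensional I" by (auto simp: space_PiM PiE_def)
      show "(\<Prod>i\<in>I. h (x i)) * indicator (Pi\<^sub>E I A) x = (\<Prod>i\<in>I. h (x i) * indicator (A i) (x i))"
      proof (cases "\<forall>i\<in>I. x i \<in> A i")
        case True
        then show ?thesis using ext by (auto simp: PiE_def)
      next
        case False
        then obtain j where j: "j \<in> I" "x j \<notin> A j" by auto
        then have "h (x j) * indicator (A j) (x j) = 0" by simp
        then have "(\<Prod>i\<in>I. h (x i) * indicator (A i) (x i)) = 0"
          using I j(1) by (meson prod_zero)
        moreover have "x \<notin> Pi\<^sub>E I A" using j by auto
        ultimately show ?thesis by simp
      qed
    qed
    also have "\<dots> = (\<Prod>i\<in>I. \<integral>\<^sup>+y. h y * indicator (A i) y \<partial>P)"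
      using A I by (intro PP.product_nn_integral_prod) auto
    also have "\<dots> = (\<Prod>i\<in>I. emeasure (density P h) (A i))"
      using A by (intro prod.cong) (auto simp: emeasure_density)
    finally show "emeasure (density (PiM I (\<lambda>_. P)) (\<lambda>x. \<Prod>i\<in>I. h (x i))) (Pi\<^sub>E I A) =
      (\<Prod>i\<in>I. emeasure (density P h) (A i))" .
  qed (use I in simp)
qed

text \<open>With \<open>i\<close> the indicator of an event and \<open>L\<close> a likelihood ratio, this is a subtraction-free form of
  \<open>1 - L \<le> 1/4 + (1 - L)\<^sup>2\<close> on the event and of \<open>0 \<le> 1/4 + (1 - L)\<^sup>2\<close> off it.\<close>

lemma likelihood_ratio_pointwise_bound:
  fixes L i :: ennreal
  assumes "i = 0 \<or> i = 1"
  shows "i + 2 * L \<le> L * i + (5/4 + L\<^sup>2)"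
proof (cases L)
  case (real l)
  then have L: "L = ennreal l" by simp
  have fe: "(5/4 :: ennreal) = ennreal (5/4)"
    by (metis ennreal_divide_numeral ennreal_numeral zero_le_numeral)
  have "0 \<le> (l - 1/2)\<^sup>2" "0 \<le> (l - 1)\<^sup>2" by auto
  then have r: "1 + 2 * l \<le> l + (5/4 + l\<^sup>2)" "2 * l \<le> 5/4 + l\<^sup>2"
    by (auto simp: power2_eq_square algebra_simps)
  have two: "2 * ennreal l = ennreal (2 * l)" using real by (simp add: ennreal_mult)
  have one: "1 + ennreal (2 * l) = ennreal (1 + 2 * l)" using real
    by (subst ennreal_1[symmetric], subst ennreal_plus[symmetric]) auto
  have sq: "5/4 + (ennreal l)\<^sup>2 = ennreal (5/4 + l\<^sup>2)"
    using real by (simp add: fe ennreal_power)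
  have sq2: "ennreal l + ennreal (5/4 + l\<^sup>2) = ennreal (l + (5/4 + l\<^sup>2))"
    using real by (subst ennreal_plus[symmetric]) auto
  show ?thesis using assms
  proof
    assume "i = 0" then show ?thesis unfolding L two sq
      using r(2) by (simp del: ennreal_plus add: ennreal_leI)
  next
    assume "i = 1"
    show ?thesis unfolding L two sq \<open>i = 1\<close> mult_1_right sq2 one
      by (rule ennreal_leI) (rule r(1))
  qed
next
  case top
  then show ?thesis by (simp add: power2_eq_square ennreal_top_mult)
qed

text \<open>The second moment of the likelihood ratio of the product laws is the \<open>card I\<close>-th power of that of
  one coordinate; integrating the pointwise bound turns it into a comparison of probabilities. The
  constant \<open>3/4\<close> is \<open>1 - 1/4\<close>: the error is \<open>1/4\<close> plus a bound on the variance of the likelihood ratio, and \<open>1/4\<close>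
  is affordable because the coverage \<open>1 - \<alpha>\<close> exceeds \<open>1/2\<close>.\<close>

lemma product_law_event_bound:
  fixes h :: "'a \<Rightarrow> ennreal"
  assumes P: "prob_space P" and Q: "prob_space (density P h)"
    and h[measurable]: "h \<in> borel_measurable P" and I: "finite I"
    and s: "0 \<le> s" and second: "(\<integral>\<^sup>+x. (h x)\<^sup>2 \<partial>P) \<le> ennreal (1 + s)"
    and A: "A \<in> sets (PiM I (\<lambda>_. P))"
  shows "measure (PiM I (\<lambda>_. P)) A
    \<le> measure (PiM I (\<lambda>_. density P h)) A + (1 + s) ^ card I - 3/4"
proof -
  interpret P: prob_space P by fact
  interpret Q: prob_space "density P h" by fact
  interpret PP: product_prob_space "\<lambda>_. P" I by unfold_locales
  interpret QQ: product_prob_space "\<lambda>_. density P h" I by unfold_locales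
  let ?P = "PiM I (\<lambda>_. P)" and ?Q = "PiM I (\<lambda>_. density P h)"
  define L where "L = (\<lambda>x. \<Prod>i\<in>I. h (x i))"
  have L[measurable]: "L \<in> borel_measurable ?P" unfolding L_def by measurable
  have Q_eq: "?Q = density ?P L"
    unfolding L_def by (rule PiM_density) fact+
  have int_h: "(\<integral>\<^sup>+x. h x \<partial>P) = 1"
    using Q.emeasure_space_1 by (simp add: emeasure_density cong: nn_integral_cong)
  have L1: "(\<integral>\<^sup>+x. L x \<partial>?P) = 1"
    unfolding L_def using I by (subst PP.product_nn_integral_prod) (auto simp: int_h)
  have "(\<integral>\<^sup>+x. (L x)\<^sup>2 \<partial>?P) = (\<Prod>i\<in>I. \<integral>\<^sup>+x. (h x)\<^sup>2 \<partial>P)"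
    unfolding L_def prod_power_distrib
    using I by (subst PP.product_nn_integral_prod) auto
  also have "\<dots> \<le> ennreal (1 + s) ^ card I"
    using second by (simp add: power_mono)
  also have "\<dots> = ennreal ((1 + s) ^ card I)" using s by (intro ennreal_power) simp
  finally have L2: "(\<integral>\<^sup>+x. (L x)\<^sup>2 \<partial>?P) \<le> ennreal ((1 + s) ^ card I)" .
  have "emeasure ?P A + 2 = (\<integral>\<^sup>+x. indicator A x + 2 * L x \<partial>?P)"
    using A L1 by (subst nn_integral_add) (auto simp: nn_integral_cmult)
  also have "\<dots> \<le> (\<integral>\<^sup>+x. L x * indicator A x + (5/4 + (L x)\<^sup>2) \<partial>?P)"
    by (intro nn_integral_mono likelihood_ratio_pointwise_bound) (auto simp: indicator_def)
  also have "\<dots> = emeasure ?Q A + (5/4 + (\<integral>\<^sup>+x. (L x)\<^sup>2 \<partial>?P))"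
    unfolding Q_eq using A
    by (simp add: nn_integral_add emeasure_density PP.P.emeasure_space_1)
  also have "\<dots> \<le> emeasure ?Q A + (5/4 + ennreal ((1 + s) ^ card I))"
    using L2 by (intro add_left_mono)
  finally have le: "emeasure ?P A + 2 \<le> emeasure ?Q A + (5/4 + ennreal ((1 + s) ^ card I))" .
  have fe: "(5/4 :: ennreal) = ennreal (5/4)"
    by (metis ennreal_divide_numeral ennreal_numeral zero_le_numeral)
  have two: "(2::ennreal) = ennreal 2" by simp
  have pw: "0 \<le> (1 + s) ^ card I" using s by simp
  have "ennreal (measure ?P A + 2) \<le> ennreal (measure ?Q A + (5/4 + (1 + s) ^ card I))"
    using le pw unfolding PP.P.emeasure_eq_measure QQ.P.emeasure_eq_measure fe two
    by (simp add: ennreal_plus del: ennreal_plus[symmetric] ennreal_numeral)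
  then show ?thesis using pw by (subst (asm) ennreal_le_iff) auto
qed

section \<open>Gaussian mixtures\<close>

definition mixture_density :: "real \<Rightarrow> real \<Rightarrow> real \<Rightarrow> real" where
  "mixture_density \<epsilon> \<mu> x = (1 - \<epsilon>) * normal_density 0 1 x + \<epsilon> * normal_density \<mu> 1 x"

lemma borel_measurable_mixture_density [measurable]:
  "mixture_density \<epsilon> \<mu> \<in> borel_measurable borel"
  unfolding mixture_density_def[abs_def] by measurable

lemma mixture_eq_density:
  "mixture \<epsilon> \<mu> = density lborel (\<lambda>x. ennreal (mixture_density \<epsilon> \<mu> x))"
  unfolding mixture_def mixture_density_def ..

definition chi_square :: "real \<Rightarrow> real \<Rightarrow> real \<Rightarrow> real \<Rightarrow> ennreal" where
  "chi_square \<epsilon>\<^sub>0 \<mu>\<^sub>0 \<epsilon>\<^sub>1 \<mu>\<^sub>1 = (\<integral>\<^sup>+x. ennreal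
     ((mixture_density \<epsilon>\<^sub>1 \<mu>\<^sub>1 x - mixture_density \<epsilon>\<^sub>0 \<mu>\<^sub>0 x)\<^sup>2 / mixture_density \<epsilon>\<^sub>0 \<mu>\<^sub>0 x) \<partial>lborel)"

lemma nn_integral_normal_density:
  "(\<integral>\<^sup>+x. ennreal (normal_density \<mu> 1 x) \<partial>lborel) = 1"
  by (subst nn_integral_eq_integral) auto

lemma mixture_density_pos:
  assumes "0 \<le> \<epsilon>" "\<epsilon> \<le> 1"
  shows "0 < mixture_density \<epsilon> \<mu> x"
proof (cases "\<epsilon> = 0")
  case False
  then have "0 < \<epsilon> * normal_density \<mu> 1 x" using assms by (simp add: normal_density_pos)
  moreover have "0 \<le> (1 - \<epsilon>) * normal_density 0 1 x" using assms by simp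
  ultimately show ?thesis unfolding mixture_density_def by linarith
qed (simp add: normal_density_pos mixture_density_def)

lemma nn_integral_mixture_density:
  assumes "0 \<le> \<epsilon>" "\<epsilon> \<le> 1"
  shows "(\<integral>\<^sup>+x. ennreal (mixture_density \<epsilon> \<mu> x) \<partial>lborel) = 1"
proof -
  have "(\<integral>\<^sup>+x. ennreal (mixture_density \<epsilon> \<mu> x) \<partial>lborel)
      = (\<integral>\<^sup>+x. ennreal (1 - \<epsilon>) * ennreal (normal_density 0 1 x)
          + ennreal \<epsilon> * ennreal (normal_density \<mu> 1 x) \<partial>lborel)"
    using assms by (intro nn_integral_cong) (simp add: ennreal_mult mixture_density_def)
  also have "\<dots> = ennreal (1 - \<epsilon>) + ennreal \<epsilon>"
    by (simp add: nn_integral_add nn_integral_cmult nn_integral_normal_density)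
  also have "\<dots> = 1" using assms by (simp flip: ennreal_plus)
  finally show ?thesis .
qed

lemma prob_space_mixture:
  assumes "0 \<le> \<epsilon>" "\<epsilon> \<le> 1"
  shows "prob_space (mixture \<epsilon> \<mu>)"
  using nn_integral_mixture_density[OF assms] unfolding mixture_eq_density
  by (intro prob_spaceI) (simp add: emeasure_density cong: nn_integral_cong)

lemma mixture_change_of_measure:
  assumes "0 \<le> \<epsilon>\<^sub>0" "\<epsilon>\<^sub>0 \<le> 1" "0 \<le> \<epsilon>\<^sub>1" "\<epsilon>\<^sub>1 \<le> 1"
  shows "mixture \<epsilon>\<^sub>1 \<mu>\<^sub>1 = density (mixture \<epsilon>\<^sub>0 \<mu>\<^sub>0)
    (\<lambda>x. ennreal (mixture_density \<epsilon>\<^sub>1 \<mu>\<^sub>1 x / mixture_density \<epsilon>\<^sub>0 \<mu>\<^sub>0 x))"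
proof -
  have "mixture_density \<epsilon>\<^sub>0 \<mu>\<^sub>0 x \<noteq> 0" "0 \<le> mixture_density \<epsilon>\<^sub>0 \<mu>\<^sub>0 x"
    "0 \<le> mixture_density \<epsilon>\<^sub>1 \<mu>\<^sub>1 x" for x
    using mixture_density_pos[OF assms(1,2), of \<mu>\<^sub>0 x] mixture_density_pos[OF assms(3,4), of \<mu>\<^sub>1 x]
    by (simp_all add: less_imp_le)
  then show ?thesis unfolding mixture_eq_density
    by (subst density_density_eq) (auto intro!: density_cong simp flip: ennreal_mult)
qed

text \<open>Integrate \<open>g\<^sup>2 / f + f = (g - f)\<^sup>2 / f + 2 g\<close> for the two densities \<open>f\<close> and \<open>g\<close>; the added \<open>f\<close>
  avoids subtraction of extended reals.\<close>

lemma likelihood_ratio_second_moment: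
  assumes "0 \<le> \<epsilon>\<^sub>0" "\<epsilon>\<^sub>0 \<le> 1" "0 \<le> \<epsilon>\<^sub>1" "\<epsilon>\<^sub>1 \<le> 1"
  shows "(\<integral>\<^sup>+x. (ennreal (mixture_density \<epsilon>\<^sub>1 \<mu>\<^sub>1 x / mixture_density \<epsilon>\<^sub>0 \<mu>\<^sub>0 x))\<^sup>2
      \<partial>mixture \<epsilon>\<^sub>0 \<mu>\<^sub>0) = 1 + chi_square \<epsilon>\<^sub>0 \<mu>\<^sub>0 \<epsilon>\<^sub>1 \<mu>\<^sub>1"
    (is "?X = _")
proof -
  let ?f = "mixture_density \<epsilon>\<^sub>0 \<mu>\<^sub>0" and ?g = "mixture_density \<epsilon>\<^sub>1 \<mu>\<^sub>1"
  have f: "0 < ?f x" and g: "0 < ?g x" for x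
    using assms by (simp_all add: mixture_density_pos)
  have "?X = (\<integral>\<^sup>+x. ennreal ((?g x)\<^sup>2 / ?f x) \<partial>lborel)"
    unfolding mixture_eq_density
  proof (subst nn_integral_density)
    have "ennreal (?f x) * (ennreal (?g x / ?f x))\<^sup>2 = ennreal ((?g x)\<^sup>2 / ?f x)" for x
      using f[of x] g[of x]
      by (simp add: ennreal_power flip: ennreal_mult) (simp add: field_simps power2_eq_square)
    then show "(\<integral>\<^sup>+x. ennreal (?f x) * (ennreal (?g x / ?f x))\<^sup>2 \<partial>lborel) =
      (\<integral>\<^sup>+x. ennreal ((?g x)\<^sup>2 / ?f x) \<partial>lborel)" by simp
  qed auto
  then have "?X + 1 = (\<integral>\<^sup>+x. ennreal ((?g x)\<^sup>2 / ?f x) + ennreal (?f x) \<partial>lborel)"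
    using assms by (simp add: nn_integral_add nn_integral_mixture_density)
  also have "\<dots> = (\<integral>\<^sup>+x. ennreal ((?g x - ?f x)\<^sup>2 / ?f x) + 2 * ennreal (?g x) \<partial>lborel)"
  proof (rule nn_integral_cong)
    fix x
    have "(a::real)\<^sup>2 / b + b = (a - b)\<^sup>2 / b + 2 * a" if "b > 0" for a b
      using that by (simp add: field_simps power2_eq_square)
    from this[OF f[of x], of "?g x"]
    have "ennreal ((?g x)\<^sup>2 / ?f x + ?f x) = ennreal ((?g x - ?f x)\<^sup>2 / ?f x + 2 * ?g x)" by simp
    then show "ennreal ((?g x)\<^sup>2 / ?f x) + ennreal (?f x)
        = ennreal ((?g x - ?f x)\<^sup>2 / ?f x) + 2 * ennreal (?g x)"
      using f[of x] g[of x] less_imp_le[OF f[of x]] less_imp_le[OF g[of x]]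
      by (subst (asm) (1 2) ennreal_plus) (auto simp: ennreal_mult intro!: divide_nonneg_pos)
  qed
  also have "\<dots> = chi_square \<epsilon>\<^sub>0 \<mu>\<^sub>0 \<epsilon>\<^sub>1 \<mu>\<^sub>1 + 2"
    unfolding chi_square_def using assms
    by (simp add: nn_integral_add nn_integral_cmult nn_integral_mixture_density)
  finally have "?X + 1 = (1 + chi_square \<epsilon>\<^sub>0 \<mu>\<^sub>0 \<epsilon>\<^sub>1 \<mu>\<^sub>1) + 1"
    by (simp add: add.assoc add.commute flip: one_add_one)
  then have "1 + ?X = 1 + (1 + chi_square \<epsilon>\<^sub>0 \<mu>\<^sub>0 \<epsilon>\<^sub>1 \<mu>\<^sub>1)" by (simp only: add.commute)
  then show ?thesis by (simp only: ennreal_add_left_cancel) simp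
qed

text \<open>Consider the event that the confidence limit is at most \<open>\<epsilon>\<^sub>0\<close>. Its probability exceeds \<open>1/2\<close> under
  \<open>(\<epsilon>\<^sub>0, \<mu>\<^sub>0)\<close> by coverage, so it is at least \<open>1/2 - 1/4 - 1/16 = 3/16\<close> under \<open>(\<epsilon>\<^sub>1, \<mu>\<^sub>1)\<close>, where the loss
  on it is at least \<open>1 - \<epsilon>\<^sub>0 / \<epsilon>\<^sub>1\<close>.\<close>

lemma minimax_risk_two_points:
  assumes \<alpha>: "\<alpha> < 1/2"
    and \<epsilon>: "0 < \<epsilon>\<^sub>0" "\<epsilon>\<^sub>0 < \<epsilon>\<^sub>1" "\<epsilon>\<^sub>1 \<le> 1"
    and \<Omega>: "(\<epsilon>\<^sub>0, \<mu>\<^sub>0) \<in> \<Omega>" "(\<epsilon>\<^sub>1, \<mu>\<^sub>1) \<in> \<Omega>"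
    and chi: "chi_square \<epsilon>\<^sub>0 \<mu>\<^sub>0 \<epsilon>\<^sub>1 \<mu>\<^sub>1 \<le> ennreal s" "0 \<le> s" "n * s \<le> 1/32"
  shows "minimax_risk n \<Omega> \<alpha> \<ge> ennreal (3/16 * (1 - \<epsilon>\<^sub>0 / \<epsilon>\<^sub>1))"
  unfolding minimax_risk_def
proof (rule INF_greatest)
  fix est assume "est \<in> {est. lower_confidence_limit n \<Omega> \<alpha> est}"
  then have est_m: "est \<in> borel_measurable (PiM {1..n} (\<lambda>_. borel))"
    and cov: "1 - \<alpha> \<le> (INF (\<epsilon>, \<mu>)\<in>\<Omega>.
        measure (sample_law n \<epsilon> \<mu>) {x \<in> space (sample_law n \<epsilon> \<mu>). \<epsilon> \<ge> est x})"
    unfolding lower_confidence_limit_def by auto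
  define h where "h = (\<lambda>x. ennreal (mixture_density \<epsilon>\<^sub>1 \<mu>\<^sub>1 x / mixture_density \<epsilon>\<^sub>0 \<mu>\<^sub>0 x))"
  have \<epsilon>': "0 \<le> \<epsilon>\<^sub>0" "\<epsilon>\<^sub>0 \<le> 1" "0 \<le> \<epsilon>\<^sub>1" "\<epsilon>\<^sub>1 \<le> 1" using \<epsilon> by auto
  have Q_eq: "mixture \<epsilon>\<^sub>1 \<mu>\<^sub>1 = density (mixture \<epsilon>\<^sub>0 \<mu>\<^sub>0) h"
    unfolding h_def using \<epsilon>' by (rule mixture_change_of_measure)
  have P: "prob_space (mixture \<epsilon>\<^sub>0 \<mu>\<^sub>0)" and Q: "prob_space (density (mixture \<epsilon>\<^sub>0 \<mu>\<^sub>0) h)"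
    unfolding Q_eq[symmetric] using \<epsilon>' by (auto intro: prob_space_mixture)
  have sets_law: "sets (sample_law n \<epsilon> \<mu>) = sets (PiM {1..n} (\<lambda>_. borel))" for \<epsilon> \<mu>
    unfolding sample_law_def by (rule sets_PiM_cong) (auto simp: mixture_def)
  have space_law: "space (sample_law n \<epsilon> \<mu>) = space (PiM {1..n} (\<lambda>_. borel))" for \<epsilon> \<mu>
    by (rule sets_eq_imp_space_eq) (rule sets_law)
  define A where "A = {x \<in> space (PiM {1..n} (\<lambda>_. borel :: real measure)). est x \<le> \<epsilon>\<^sub>0}"
  have A: "A \<in> sets (sample_law n \<epsilon> \<mu>)" for \<epsilon> \<mu>
    unfolding sets_law A_def using est_m by measurable
  have "1 - \<alpha> \<le> measure (sample_law n \<epsilon>\<^sub>0 \<mu>\<^sub>0) A"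
  proof -
    have "(INF (\<epsilon>, \<mu>)\<in>\<Omega>. measure (sample_law n \<epsilon> \<mu>) {x \<in> space (sample_law n \<epsilon> \<mu>). \<epsilon> \<ge> est x})
      \<le> (case (\<epsilon>\<^sub>0, \<mu>\<^sub>0) of (\<epsilon>, \<mu>) \<Rightarrow>
          measure (sample_law n \<epsilon> \<mu>) {x \<in> space (sample_law n \<epsilon> \<mu>). \<epsilon> \<ge> est x})"
      using \<Omega>(1) by (intro cINF_lower bdd_belowI2[where m = 0]) auto
    then show ?thesis using cov by (simp add: A_def space_law)
  qed
  also have "\<dots> \<le> measure (sample_law n \<epsilon>\<^sub>1 \<mu>\<^sub>1) A + (1 + s) ^ card {1..n} - 3/4"
    unfolding sample_law_def Q_eq
  proof (rule product_law_event_bound[OF P Q])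
    show "(\<integral>\<^sup>+x. (h x)\<^sup>2 \<partial>mixture \<epsilon>\<^sub>0 \<mu>\<^sub>0) \<le> ennreal (1 + s)"
      unfolding h_def likelihood_ratio_second_moment[OF \<epsilon>'] using chi by simp
  qed (use chi A in \<open>auto simp: h_def mixture_def sample_law_def\<close>)
  also have "(1 + s) ^ card {1..n} \<le> 1 + 1/16"
  proof -
    have "(1 + s) ^ n \<le> exp s ^ n" using chi by (intro power_mono) auto
    also have "\<dots> = exp (n * s)" by (simp add: exp_of_nat_mult)
    also have "\<dots> \<le> exp (1/32)" using chi by simp
    also have "\<dots> \<le> 1 + 2 * (1/32)" using exp_bound_lemma[of "1/32 :: real"] by simp
    finally show ?thesis by simp
  qed
  finally have mass: "3/16 \<le> measure (sample_law n \<epsilon>\<^sub>1 \<mu>\<^sub>1) A" using \<alpha> by simp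
  interpret Q1: prob_space "sample_law n \<epsilon>\<^sub>1 \<mu>\<^sub>1"
    unfolding sample_law_def Q_eq using Q by (intro prob_space_PiM) auto
  define \<delta> where "\<delta> = 1 - \<epsilon>\<^sub>0 / \<epsilon>\<^sub>1"
  have \<delta>: "0 \<le> \<delta>" using \<epsilon> by (simp add: \<delta>_def field_simps)
  have "ennreal (3/16 * \<delta>) \<le> ennreal \<delta> * emeasure (sample_law n \<epsilon>\<^sub>1 \<mu>\<^sub>1) A"
    using mult_left_mono[OF mass \<delta>] \<delta> unfolding Q1.emeasure_eq_measure
    by (simp flip: ennreal_mult add: ennreal_leI mult.commute)
  also have "\<dots> = (\<integral>\<^sup>+x. ennreal \<delta> * indicator A x \<partial>sample_law n \<epsilon>\<^sub>1 \<mu>\<^sub>1)"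
    using A by (simp add: nn_integral_cmult_indicator)
  also have "\<dots> \<le> risk n est \<epsilon>\<^sub>1 \<mu>\<^sub>1"
    unfolding risk_def
  proof (rule nn_integral_mono)
    fix x
    show "ennreal \<delta> * indicator A x \<le> ennreal (max (1 - est x / \<epsilon>\<^sub>1) 0)"
    proof (cases "x \<in> A")
      case True
      then have "est x / \<epsilon>\<^sub>1 \<le> \<epsilon>\<^sub>0 / \<epsilon>\<^sub>1" using \<epsilon> by (auto simp: A_def divide_right_mono)
      then show ?thesis using True by (auto simp: \<delta>_def intro!: ennreal_leI)
    qed auto
  qed
  also have "\<dots> \<le> (SUP (\<epsilon>, \<mu>)\<in>\<Omega>. risk n est \<epsilon> \<mu>)"
    using SUP_upper[OF \<Omega>(2), of "\<lambda>(\<epsilon>, \<mu>). risk n est \<epsilon> \<mu>"] by simp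
  finally show "ennreal (3/16 * (1 - \<epsilon>\<^sub>0 / \<epsilon>\<^sub>1)) \<le> (SUP (\<epsilon>, \<mu>)\<in>\<Omega>. risk n est \<epsilon> \<mu>)"
    by (simp add: \<delta>_def)
qed

section \<open>The chi-square distance of two mixtures\<close>

text \<open>The part of the chi-square distance that comes from the contaminating components; the change of
  weight of the null component is left out.\<close>

definition component_gap :: "real \<Rightarrow> real \<Rightarrow> real \<Rightarrow> real \<Rightarrow> ennreal" where
  "component_gap \<epsilon>\<^sub>0 \<mu>\<^sub>0 \<epsilon>\<^sub>1 \<mu>\<^sub>1 = (\<integral>\<^sup>+x. ennreal
     ((\<epsilon>\<^sub>1 * normal_density \<mu>\<^sub>1 1 x - \<epsilon>\<^sub>0 * normal_density \<mu>\<^sub>0 1 x)\<^sup>2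
        / mixture_density \<epsilon>\<^sub>0 \<mu>\<^sub>0 x) \<partial>lborel)"

lemma mixture_density_ge_null:
  assumes "0 \<le> \<epsilon>" "\<epsilon> \<le> 1/2"
  shows "normal_density 0 1 x / 2 \<le> mixture_density \<epsilon> \<mu> x"
proof -
  have "1/2 * normal_density 0 1 x \<le> (1 - \<epsilon>) * normal_density 0 1 x"
    using assms by (intro mult_right_mono) auto
  moreover have "0 \<le> \<epsilon> * normal_density \<mu> 1 x" using assms by simp
  ultimately show ?thesis unfolding mixture_density_def by linarith
qed

lemma mixture_density_ge_component:
  assumes "0 \<le> \<epsilon>" "\<epsilon> \<le> 1"
  shows "\<epsilon> * normal_density \<mu> 1 x \<le> mixture_density \<epsilon> \<mu> x"
  using assms by (simp add: mixture_density_def)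

text \<open>Of the two lower bounds on the mixture density, half the null density is the effective one where the
  null density dominates, and the component is so elsewhere.\<close>

lemma divide_mixture_le_null:
  assumes "0 \<le> \<epsilon>" "\<epsilon> \<le> 1/2" "0 \<le> a"
  shows "a / mixture_density \<epsilon> \<mu> x \<le> 2 * (a / normal_density 0 1 x)"
proof -
  have "a / mixture_density \<epsilon> \<mu> x \<le> a / (normal_density 0 1 x / 2)"
    using assms mixture_density_ge_null[of \<epsilon> x \<mu>] normal_density_pos[of 1 0 x]
    by (intro divide_left_mono mult_pos_pos mixture_density_pos) auto
  then show ?thesis by (simp add: mult.commute)
qed

lemma divide_mixture_le_component:
  assumes "0 < \<epsilon>" "\<epsilon> \<le> 1" "0 \<le> a"
  shows "a / mixture_density \<epsilon> \<mu> x \<le> a / (\<epsilon> * normal_density \<mu> 1 x)"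
  using assms mixture_density_ge_component[of \<epsilon> \<mu> x] normal_density_pos[of 1 \<mu> x]
  by (intro divide_left_mono mult_pos_pos mixture_density_pos) auto

text \<open>The null component changes by \<open>(\<epsilon>\<^sub>0 - \<epsilon>\<^sub>1) \<phi>\<close>, whose square over \<open>\<phi> / 2\<close> integrates to
  \<open>2 (\<epsilon>\<^sub>1 - \<epsilon>\<^sub>0)\<^sup>2\<close>; the other factor \<open>2\<close> is that of \<open>(a + b)\<^sup>2 \<le> 2 a\<^sup>2 + 2 b\<^sup>2\<close>.\<close>

lemma chi_square_le_component_gap:
  assumes "0 < \<epsilon>\<^sub>0" "\<epsilon>\<^sub>0 \<le> 1/2"
  shows "chi_square \<epsilon>\<^sub>0 \<mu>\<^sub>0 \<epsilon>\<^sub>1 \<mu>\<^sub>1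
    \<le> 2 * component_gap \<epsilon>\<^sub>0 \<mu>\<^sub>0 \<epsilon>\<^sub>1 \<mu>\<^sub>1 + ennreal (4 * (\<epsilon>\<^sub>1 - \<epsilon>\<^sub>0)\<^sup>2)"
proof -
  let ?f = "mixture_density \<epsilon>\<^sub>0 \<mu>\<^sub>0" and ?\<phi> = "normal_density 0 1"
  let ?g = "\<lambda>x. (\<epsilon>\<^sub>1 * normal_density \<mu>\<^sub>1 1 x - \<epsilon>\<^sub>0 * normal_density \<mu>\<^sub>0 1 x)"
  have "chi_square \<epsilon>\<^sub>0 \<mu>\<^sub>0 \<epsilon>\<^sub>1 \<mu>\<^sub>1
      \<le> (\<integral>\<^sup>+x. 2 * ennreal ((?g x)\<^sup>2 / ?f x) + ennreal (4 * (\<epsilon>\<^sub>1 - \<epsilon>\<^sub>0)\<^sup>2) * ennreal (?\<phi> x) \<partial>lborel)"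
    unfolding chi_square_def
  proof (rule nn_integral_mono)
    fix x
    define \<phi> where "\<phi> = ?\<phi> x"
    define d where "d = (\<epsilon>\<^sub>0 - \<epsilon>\<^sub>1) * \<phi>"
    have f: "0 < ?f x" using assms by (intro mixture_density_pos) auto
    have \<phi>: "0 < \<phi>" unfolding \<phi>_def by (simp add: normal_density_pos)
    have diff: "mixture_density \<epsilon>\<^sub>1 \<mu>\<^sub>1 x - ?f x = ?g x + d"
      by (simp add: mixture_density_def \<phi>_def d_def algebra_simps)
    have "(a + b)\<^sup>2 \<le> 2 * a\<^sup>2 + 2 * b\<^sup>2" for a b :: real
      using zero_le_power2[of "a - b"] unfolding power2_sum power2_diff by linarith
    from this[of "?g x" d] have "(?g x + d)\<^sup>2 / ?f x \<le> (2 * (?g x)\<^sup>2 + 2 * d\<^sup>2) / ?f x"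
      using f by (intro divide_right_mono) auto
    also have "\<dots> = 2 * ((?g x)\<^sup>2 / ?f x) + 2 * (d\<^sup>2 / ?f x)" by (simp add: add_divide_distrib)
    also have "d\<^sup>2 / ?f x \<le> 2 * (d\<^sup>2 / \<phi>)"
      unfolding \<phi>_def using assms by (intro divide_mixture_le_null) auto
    also have "d\<^sup>2 / \<phi> = (\<epsilon>\<^sub>1 - \<epsilon>\<^sub>0)\<^sup>2 * \<phi>"
      using \<phi> by (simp add: d_def power2_eq_square field_simps)
    finally have "(mixture_density \<epsilon>\<^sub>1 \<mu>\<^sub>1 x - ?f x)\<^sup>2 / ?f x
        \<le> 2 * ((?g x)\<^sup>2 / ?f x) + (4 * (\<epsilon>\<^sub>1 - \<epsilon>\<^sub>0)\<^sup>2) * \<phi>" unfolding diff by simp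
    then have "ennreal ((mixture_density \<epsilon>\<^sub>1 \<mu>\<^sub>1 x - ?f x)\<^sup>2 / ?f x)
        \<le> ennreal (2 * ((?g x)\<^sup>2 / ?f x) + (4 * (\<epsilon>\<^sub>1 - \<epsilon>\<^sub>0)\<^sup>2) * \<phi>)" by (rule ennreal_leI)
    also have "\<dots> = ennreal (2 * ((?g x)\<^sup>2 / ?f x)) + ennreal ((4 * (\<epsilon>\<^sub>1 - \<epsilon>\<^sub>0)\<^sup>2) * \<phi>)"
      using f \<phi> by (intro ennreal_plus) auto
    also have "\<dots> = 2 * ennreal ((?g x)\<^sup>2 / ?f x) + ennreal (4 * (\<epsilon>\<^sub>1 - \<epsilon>\<^sub>0)\<^sup>2) * ennreal \<phi>"
      using f \<phi> by (subst (1 2) ennreal_mult) auto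
    finally show "ennreal ((mixture_density \<epsilon>\<^sub>1 \<mu>\<^sub>1 x - ?f x)\<^sup>2 / ?f x)
        \<le> 2 * ennreal ((?g x)\<^sup>2 / ?f x) + ennreal (4 * (\<epsilon>\<^sub>1 - \<epsilon>\<^sub>0)\<^sup>2) * ennreal (?\<phi> x)"
      unfolding \<phi>_def .
  qed
  also have "\<dots> = 2 * component_gap \<epsilon>\<^sub>0 \<mu>\<^sub>0 \<epsilon>\<^sub>1 \<mu>\<^sub>1 + ennreal (4 * (\<epsilon>\<^sub>1 - \<epsilon>\<^sub>0)\<^sup>2)"
    unfolding component_gap_def
    by (simp add: nn_integral_add nn_integral_cmult nn_integral_normal_density)
  finally show ?thesis .
qed

lemma component_gap_equal_means:
  assumes "0 < \<epsilon>\<^sub>0" "\<epsilon>\<^sub>0 \<le> 1"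
  shows "component_gap \<epsilon>\<^sub>0 \<mu> \<epsilon>\<^sub>1 \<mu> \<le> ennreal ((\<epsilon>\<^sub>1 - \<epsilon>\<^sub>0)\<^sup>2 / \<epsilon>\<^sub>0)"
proof -
  have "component_gap \<epsilon>\<^sub>0 \<mu> \<epsilon>\<^sub>1 \<mu>
      \<le> (\<integral>\<^sup>+x. ennreal ((\<epsilon>\<^sub>1 - \<epsilon>\<^sub>0)\<^sup>2 / \<epsilon>\<^sub>0) * ennreal (normal_density \<mu> 1 x) \<partial>lborel)"
    unfolding component_gap_def
  proof (rule nn_integral_mono)
    fix x
    let ?\<phi> = "normal_density \<mu> 1 x"
    have \<phi>: "0 < ?\<phi>" by (simp add: normal_density_pos)
    have "(\<epsilon>\<^sub>1 * ?\<phi> - \<epsilon>\<^sub>0 * ?\<phi>)\<^sup>2 / mixture_density \<epsilon>\<^sub>0 \<mu> x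
        \<le> (\<epsilon>\<^sub>1 * ?\<phi> - \<epsilon>\<^sub>0 * ?\<phi>)\<^sup>2 / (\<epsilon>\<^sub>0 * ?\<phi>)"
      using assms by (intro divide_mixture_le_component) auto
    also have "\<dots> = (\<epsilon>\<^sub>1 - \<epsilon>\<^sub>0)\<^sup>2 / \<epsilon>\<^sub>0 * ?\<phi>"
      unfolding left_diff_distrib[symmetric] using assms \<phi> by (simp add: power2_eq_square)
    finally show "ennreal ((\<epsilon>\<^sub>1 * ?\<phi> - \<epsilon>\<^sub>0 * ?\<phi>)\<^sup>2 / mixture_density \<epsilon>\<^sub>0 \<mu> x)
        \<le> ennreal ((\<epsilon>\<^sub>1 - \<epsilon>\<^sub>0)\<^sup>2 / \<epsilon>\<^sub>0) * ennreal ?\<phi>"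
      using assms \<phi> by (simp flip: ennreal_mult add: ennreal_leI)
  qed
  then show ?thesis by (simp add: nn_integral_cmult nn_integral_normal_density)
qed

section \<open>Pairs whose components cross\<close>

text \<open>The constant \<open>\<eta> (A + \<eta> / 2)\<close> is chosen to make the logarithm of the ratio vanish at \<open>\<mu> + A\<close>.\<close>

lemma tilted_component:
  "\<epsilon> * exp (\<eta> * (A + \<eta> / 2)) * normal_density (\<mu> - \<eta>) 1 x
    = \<epsilon> * normal_density \<mu> 1 x * exp (- \<eta> * (x - \<mu> - A))"
proof -
  have "exp (\<eta> * (A + \<eta> / 2)) * exp (- (x - (\<mu> - \<eta>))\<^sup>2 / 2)
      = exp (- (x - \<mu>)\<^sup>2 / 2) * exp (- \<eta> * (x - \<mu> - A))"
    unfolding exp_add[symmetric] by (rule arg_cong[where f = exp]) (simp add: power2_eq_square field_simps)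
  then show ?thesis by (simp add: normal_density_def field_simps)
qed

lemma exp_minus_one_squared_le:
  fixes u :: real
  shows "(exp u - 1)\<^sup>2 \<le> u\<^sup>2 * exp (2 * \<bar>u\<bar>)"
proof -
  have "\<bar>exp u - 1\<bar> \<le> \<bar>u\<bar> * exp \<bar>u\<bar>"
  proof (cases "0 \<le> u")
    case True
    have "(1 - u) * exp u \<le> exp (- u) * exp u"
      using exp_ge_add_one_self[of "- u"] by (intro mult_right_mono) auto
    then show ?thesis using True by (simp add: exp_minus algebra_simps)
  next
    case False
    have "- u * 1 \<le> - u * exp (- u)" using False by (intro mult_left_mono) auto
    then have "1 - exp u \<le> - u * exp (- u)" using exp_ge_add_one_self[of u] by linarith
    moreover have "\<bar>exp u - 1\<bar> = 1 - exp u" "\<bar>u\<bar> = - u" using False by auto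
    ultimately show ?thesis by (simp only:)
  qed
  then have "\<bar>exp u - 1\<bar>\<^sup>2 \<le> (\<bar>u\<bar> * exp \<bar>u\<bar>)\<^sup>2" by (intro power_mono) auto
  then show ?thesis by (simp add: power_mult_distrib exp_double[symmetric])
qed

text \<open>Near the crossing the components differ to first order in \<open>\<eta>\<close>; the last exponential controls the
  tails.\<close>

lemma tilted_gap_integrand:
  assumes "0 < \<epsilon>" "\<epsilon> \<le> 1" "0 \<le> \<eta>"
  shows "(\<epsilon> * exp (\<eta> * (A + \<eta> / 2)) * normal_density (\<mu> - \<eta>) 1 x - \<epsilon> * normal_density \<mu> 1 x)\<^sup>2
      / mixture_density \<epsilon> \<mu> x
    \<le> (\<epsilon> * normal_density \<mu> 1 x)\<^sup>2 / mixture_density \<epsilon> \<mu> x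
      * (\<eta>\<^sup>2 * (x - \<mu> - A)\<^sup>2 * exp (2 * \<eta> * \<bar>x - \<mu> - A\<bar>))"
proof -
  let ?p = "\<epsilon> * normal_density \<mu> 1 x" and ?u = "- \<eta> * (x - \<mu> - A)"
  have "(\<epsilon> * exp (\<eta> * (A + \<eta> / 2)) * normal_density (\<mu> - \<eta>) 1 x - ?p)\<^sup>2 = ?p\<^sup>2 * (exp ?u - 1)\<^sup>2"
    unfolding tilted_component by (simp add: power2_eq_square algebra_simps)
  moreover have "(exp ?u - 1)\<^sup>2 \<le> \<eta>\<^sup>2 * (x - \<mu> - A)\<^sup>2 * exp (2 * \<eta> * \<bar>x - \<mu> - A\<bar>)"
    using exp_minus_one_squared_le[of ?u] assms by (simp add: power_mult_distrib abs_mult mult.assoc)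
  moreover have "0 < mixture_density \<epsilon> \<mu> x" using assms by (intro mixture_density_pos) auto
  ultimately show ?thesis
    by (simp add: mult_left_mono divide_right_mono)
qed

text \<open>Completing the square gives \<open>(\<epsilon> \<phi>(x - \<mu>))\<^sup>2 / \<phi>(x) = \<epsilon>\<^sup>2 exp (\<mu>\<^sup>2) \<phi>(x - 2 \<mu>)\<close>, so the crossing \<open>2 \<mu>\<close> is
  the centre of the weight, and what remains is an absolute Gaussian moment. That moment is bounded
  by two exponential ones, which are again Gaussian integrals.\<close>

lemma component_gap_crossing_at_twice_mean:
  assumes \<epsilon>: "0 < \<epsilon>" "\<epsilon> \<le> 1/2" and \<eta>: "0 \<le> \<eta>" "\<eta> \<le> 1/2"
  shows "component_gap \<epsilon> \<mu> (\<epsilon> * exp (\<eta> * (\<mu> + \<eta> / 2))) (\<mu> - \<eta>)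
    \<le> ennreal (8 * exp 2 * (\<epsilon>\<^sup>2 * exp (\<mu>\<^sup>2) * \<eta>\<^sup>2))"
proof -
  define K where "K = 4 * exp 2 * (\<epsilon>\<^sup>2 * exp (\<mu>\<^sup>2) * \<eta>\<^sup>2)"
  have K: "0 \<le> K" by (simp add: K_def)
  have "component_gap \<epsilon> \<mu> (\<epsilon> * exp (\<eta> * (\<mu> + \<eta> / 2))) (\<mu> - \<eta>)
    \<le> (\<integral>\<^sup>+x. ennreal K * (ennreal (normal_density (2 * \<mu> + 2) 1 x)
        + ennreal (normal_density (2 * \<mu> - 2) 1 x)) \<partial>lborel)"
    unfolding component_gap_def
  proof (rule nn_integral_mono)
    fix x
    define y where "y = x - \<mu> - \<mu>"
    let ?p = "\<epsilon> * normal_density \<mu> 1 x" and ?f = "mixture_density \<epsilon> \<mu> x"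
    have "?p\<^sup>2 / ?f \<le> 2 * (?p\<^sup>2 / normal_density 0 1 x)"
      using \<epsilon> by (intro divide_mixture_le_null) auto
    also have "?p\<^sup>2 / normal_density 0 1 x = \<epsilon>\<^sup>2 * exp (\<mu>\<^sup>2) * normal_density 0 1 y"
    proof -
      have "exp (- (x - \<mu>)\<^sup>2 / 2) * exp (- (x - \<mu>)\<^sup>2 / 2)
          = exp (\<mu>\<^sup>2) * exp (- y\<^sup>2 / 2) * exp (- x\<^sup>2 / 2)"
        unfolding exp_add[symmetric] y_def
        by (rule arg_cong[where f = exp]) (simp add: power2_eq_square field_simps)
      then have "(normal_density \<mu> 1 x)\<^sup>2 = exp (\<mu>\<^sup>2) * normal_density 0 1 y * normal_density 0 1 x"
        by (simp add: normal_density_def power2_eq_square field_simps)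
      then show ?thesis using normal_density_pos[of 1 0 x] by (simp add: power_mult_distrib)
    qed
    finally have p: "?p\<^sup>2 / ?f \<le> 2 * (\<epsilon>\<^sup>2 * exp (\<mu>\<^sup>2) * normal_density 0 1 y)" .
    have "y\<^sup>2 * exp (2 * \<eta> * \<bar>y\<bar>) \<le> (2 * exp \<bar>y\<bar>) * exp \<bar>y\<bar>"
    proof (rule mult_mono)
      show "y\<^sup>2 \<le> 2 * exp \<bar>y\<bar>" using exp_lower_Taylor_quadratic[of "\<bar>y\<bar>"] by simp
      have "2 * \<eta> * \<bar>y\<bar> \<le> 1 * \<bar>y\<bar>" using \<eta> by (intro mult_right_mono) auto
      then show "exp (2 * \<eta> * \<bar>y\<bar>) \<le> exp \<bar>y\<bar>" by simp
    qed auto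
    also have "\<dots> = 2 * exp (2 * \<bar>y\<bar>)" by (simp flip: exp_add)
    also have "\<dots> \<le> 2 * (exp (2 * y) + exp (- 2 * y))" by (simp add: abs_if)
    finally have y: "\<eta>\<^sup>2 * y\<^sup>2 * exp (2 * \<eta> * \<bar>y\<bar>) \<le> \<eta>\<^sup>2 * (2 * (exp (2 * y) + exp (- 2 * y)))"
      unfolding mult.assoc[of "\<eta>\<^sup>2"] by (rule mult_left_mono) simp
    have shift: "normal_density 0 1 y * exp (c * y) = exp (c\<^sup>2 / 2) * normal_density (2 * \<mu> + c) 1 x" for c
    proof -
      have "exp (- y\<^sup>2 / 2) * exp (c * y) = exp (c\<^sup>2 / 2) * exp (- (x - (2 * \<mu> + c))\<^sup>2 / 2)"
        unfolding exp_add[symmetric] y_def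
        by (rule arg_cong[where f = exp]) (simp add: power2_eq_square field_simps)
      then show ?thesis by (simp add: normal_density_def)
    qed
    have "(\<epsilon> * exp (\<eta> * (\<mu> + \<eta> / 2)) * normal_density (\<mu> - \<eta>) 1 x - ?p)\<^sup>2 / ?f
        \<le> ?p\<^sup>2 / ?f * (\<eta>\<^sup>2 * y\<^sup>2 * exp (2 * \<eta> * \<bar>y\<bar>))"
      unfolding y_def using \<epsilon> \<eta> by (intro tilted_gap_integrand) auto
    also have "\<dots> \<le> (2 * (\<epsilon>\<^sup>2 * exp (\<mu>\<^sup>2) * normal_density 0 1 y))
        * (\<eta>\<^sup>2 * (2 * (exp (2 * y) + exp (- 2 * y))))"
      using p y by (rule mult_mono) auto
    also have "\<dots> = (4 * (\<epsilon>\<^sup>2 * exp (\<mu>\<^sup>2) * \<eta>\<^sup>2)) *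
        (normal_density 0 1 y * exp (2 * y) + normal_density 0 1 y * exp (- 2 * y))"
      by (simp add: algebra_simps)
    also have "\<dots> = K * (normal_density (2 * \<mu> + 2) 1 x + normal_density (2 * \<mu> - 2) 1 x)"
      using shift[of 2] shift[of "-2"] by (simp add: K_def algebra_simps)
    finally show "ennreal ((\<epsilon> * exp (\<eta> * (\<mu> + \<eta> / 2)) * normal_density (\<mu> - \<eta>) 1 x - ?p)\<^sup>2 / ?f)
      \<le> ennreal K * (ennreal (normal_density (2 * \<mu> + 2) 1 x)
        + ennreal (normal_density (2 * \<mu> - 2) 1 x))"
      using K by (simp flip: ennreal_mult ennreal_plus add: ennreal_leI)
  qed
  also have "\<dots> = ennreal K * 2"
    by (simp add: nn_integral_cmult nn_integral_add nn_integral_normal_density)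
  also have "\<dots> = ennreal (8 * exp 2 * (\<epsilon>\<^sup>2 * exp (\<mu>\<^sup>2) * \<eta>\<^sup>2))"
  proof -
    have "ennreal K * 2 = ennreal (K * 2)" using K by (simp add: ennreal_mult)
    then show ?thesis by (simp add: K_def mult.commute mult.left_commute)
  qed
  finally show ?thesis .
qed

text \<open>Each half of the integrand is a multiple of a gamma density with shape 3.\<close>

lemma nn_integral_square_exp_abs:
  assumes a: "0 < a"
  shows "(\<integral>\<^sup>+x. ennreal ((x - z)\<^sup>2 * exp (- a * \<bar>x - z\<bar>)) \<partial>lborel) \<le> ennreal (4 / a ^ 3)"
proof -
  let ?e = "erlang_density 2 a"
  have [simp]: "(\<integral>\<^sup>+x. ennreal (?e x) \<partial>lborel) = 1"
    using prob_space.emeasure_space_1[OF prob_space_erlang_density[OF a, of 2]]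
    by (simp add: emeasure_density cong: nn_integral_cong)
  have e1: "(\<integral>\<^sup>+x. ennreal (?e (x - z)) \<partial>lborel) = 1"
    using nn_integral_real_affine[of "\<lambda>x. ennreal (?e x)" 1 "- z"] by simp
  have e2: "(\<integral>\<^sup>+x. ennreal (?e (z - x)) \<partial>lborel) = 1"
    using nn_integral_real_affine[of "\<lambda>x. ennreal (?e x)" "-1" z] by simp
  have "(\<integral>\<^sup>+x. ennreal ((x - z)\<^sup>2 * exp (- a * \<bar>x - z\<bar>)) \<partial>lborel)
      \<le> (\<integral>\<^sup>+x. ennreal (2 / a ^ 3) * (ennreal (?e (x - z)) + ennreal (?e (z - x))) \<partial>lborel)"
  proof (rule nn_integral_mono)
    fix x
    have "y\<^sup>2 * exp (- a * \<bar>y\<bar>) \<le> 2 / a ^ 3 * (?e y + ?e (- y))" for y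
      using a by (cases y "0::real" rule: linorder_cases)
        (simp_all add: erlang_density_def numeral_2_eq_2 numeral_3_eq_3)
    from this[of "x - z"]
    show "ennreal ((x - z)\<^sup>2 * exp (- a * \<bar>x - z\<bar>))
        \<le> ennreal (2 / a ^ 3) * (ennreal (?e (x - z)) + ennreal (?e (z - x)))"
      using a by (simp flip: ennreal_mult ennreal_plus add: ennreal_leI)
  qed
  also have "\<dots> = ennreal (2 / a ^ 3) * 2"
    by (simp add: nn_integral_cmult nn_integral_add e1 e2)
  also have "\<dots> = ennreal (2 / a ^ 3 * 2)" using a by (subst ennreal_mult) auto
  finally show ?thesis by simp
qed

text \<open>Let \<open>x\<^sub>0 = \<mu> + A\<close> be the crossing. To the right of \<open>x\<^sub>0\<close> the weight is at most the component \<open>p\<close>, whose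
  logarithm has slope \<open>- A\<close> at \<open>x\<^sub>0\<close>; to the left it is at most \<open>2 p\<^sup>2 / \<phi>\<close>, whose logarithm has slope
  \<open>\<mu> - A\<close> there. Both logarithms are concave, so the weight decays at rate \<open>\<kappa>\<close> on both sides.
  The assumption \<open>peak\<close> says that \<open>x\<^sub>0\<close> is, up to the factor \<open>m\<close>, not beyond the point where the
  component overtakes the null density; it makes the two bounds comparable at \<open>x\<^sub>0\<close>.\<close>

lemma component_gap_crossing_at_dominance_point:
  assumes \<epsilon>: "0 < \<epsilon>" "\<epsilon> \<le> 1/2" and \<kappa>: "0 < \<kappa>" "\<kappa> \<le> A" "\<kappa> \<le> \<mu> - A"
    and \<eta>: "0 \<le> \<eta>" "4 * \<eta> \<le> \<kappa>" and m: "1 \<le> m"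
    and peak: "\<epsilon> * normal_density 0 1 A \<le> m * normal_density 0 1 (\<mu> + A)"
  shows "component_gap \<epsilon> \<mu> (\<epsilon> * exp (\<eta> * (A + \<eta> / 2))) (\<mu> - \<eta>)
    \<le> ennreal (64 * m * (\<epsilon> * normal_density 0 1 A * \<eta>\<^sup>2 / \<kappa> ^ 3))"
proof -
  define p\<^sub>0 where "p\<^sub>0 = \<epsilon> * normal_density 0 1 A"
  define K where "K = 2 * m * p\<^sub>0 * \<eta>\<^sup>2"
  have p\<^sub>0: "0 < p\<^sub>0" using \<epsilon> by (simp add: p\<^sub>0_def normal_density_pos)
  have K: "0 \<le> K" using p\<^sub>0 m by (simp add: K_def)
  have "component_gap \<epsilon> \<mu> (\<epsilon> * exp (\<eta> * (A + \<eta> / 2))) (\<mu> - \<eta>)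
    \<le> (\<integral>\<^sup>+x. ennreal K * ennreal ((x - (\<mu> + A))\<^sup>2 * exp (- (\<kappa>/2) * \<bar>x - (\<mu> + A)\<bar>)) \<partial>lborel)"
    unfolding component_gap_def
  proof (rule nn_integral_mono)
    fix x
    define y where "y = x - \<mu> - A"
    have y': "x - (\<mu> + A) = y" by (simp add: y_def)
    let ?p = "\<epsilon> * normal_density \<mu> 1 x" and ?f = "mixture_density \<epsilon> \<mu> x"
    have ppos: "0 < ?p" using \<epsilon> by (simp add: normal_density_pos)
    have p_eq: "?p = p\<^sub>0 * exp (- A * y - y\<^sup>2 / 2)"
    proof -
      have "exp (- (x - \<mu>)\<^sup>2 / 2) = exp (- A\<^sup>2 / 2) * exp (- A * y - y\<^sup>2 / 2)"
        unfolding exp_add[symmetric] y_def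
        by (rule arg_cong[where f = exp]) (simp add: power2_eq_square field_simps)
      then show ?thesis by (simp add: p\<^sub>0_def normal_density_def)
    qed
    have \<phi>_eq: "normal_density 0 1 x = normal_density 0 1 (\<mu> + A) * exp (- (\<mu> + A) * y - y\<^sup>2 / 2)"
    proof -
      have "exp (- x\<^sup>2 / 2) = exp (- (\<mu> + A)\<^sup>2 / 2) * exp (- (\<mu> + A) * y - y\<^sup>2 / 2)"
        unfolding exp_add[symmetric] y_def
        by (rule arg_cong[where f = exp]) (simp add: power2_eq_square field_simps)
      then show ?thesis by (simp add: normal_density_def)
    qed
    have p: "?p\<^sup>2 / ?f \<le> 2 * m * p\<^sub>0 * exp (- \<kappa> * \<bar>y\<bar>)"
    proof (cases "0 \<le> y")
      case True
      have "?p\<^sup>2 / ?f \<le> ?p\<^sup>2 / ?p" using \<epsilon> by (intro divide_mixture_le_component) auto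
      also have "\<dots> = ?p" using ppos by (simp add: power2_eq_square)
      also have "\<dots> \<le> p\<^sub>0 * exp (- \<kappa> * \<bar>y\<bar>)"
      proof -
        have "\<kappa> * y \<le> A * y" using True \<kappa> by (intro mult_right_mono) auto
        moreover have "0 \<le> y\<^sup>2 / 2" by simp
        ultimately have "- A * y - y\<^sup>2 / 2 \<le> - \<kappa> * \<bar>y\<bar>"
          using True unfolding mult_minus_left by linarith
        then show ?thesis unfolding p_eq using p\<^sub>0 by simp
      qed
      also have "\<dots> \<le> 2 * m * (p\<^sub>0 * exp (- \<kappa> * \<bar>y\<bar>))"
        using m p\<^sub>0 mult_right_mono[of 1 "2 * m" "p\<^sub>0 * exp (- \<kappa> * \<bar>y\<bar>)"] by simp
      finally show ?thesis by (simp add: mult.assoc)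
    next
      case False
      have "?p\<^sup>2 / ?f \<le> 2 * (?p\<^sup>2 / normal_density 0 1 x)"
        using \<epsilon> by (intro divide_mixture_le_null) auto
      also have "?p\<^sup>2 / normal_density 0 1 x
          = (p\<^sub>0 / normal_density 0 1 (\<mu> + A)) * (p\<^sub>0 * exp ((\<mu> - A) * y - y\<^sup>2 / 2))"
      proof -
        have e: "(exp (- A * y - y\<^sup>2 / 2))\<^sup>2 / exp (- (\<mu> + A) * y - y\<^sup>2 / 2) = exp ((\<mu> - A) * y - y\<^sup>2 / 2)"
          unfolding exp_double[symmetric] exp_diff[symmetric]
          by (rule arg_cong[where f = exp]) (simp add: algebra_simps)
        have alg: "(p\<^sub>0 * E)\<^sup>2 / (\<phi> * F) = p\<^sub>0 / \<phi> * (p\<^sub>0 * (E\<^sup>2 / F))" for E F \<phi> :: real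
          by (simp add: power2_eq_square)
        show ?thesis unfolding p_eq \<phi>_eq by (simp only: alg e)
      qed
      also have "\<dots> \<le> m * (p\<^sub>0 * exp (- \<kappa> * \<bar>y\<bar>))"
      proof (rule mult_mono)
        show "p\<^sub>0 / normal_density 0 1 (\<mu> + A) \<le> m"
          using peak normal_density_pos[of 1 0 "\<mu> + A"] by (simp add: p\<^sub>0_def divide_le_eq)
        have "(\<mu> - A) * y \<le> \<kappa> * y" using False \<kappa> by (intro mult_right_mono_neg) auto
        moreover have "0 \<le> y\<^sup>2 / 2" by simp
        ultimately have "(\<mu> - A) * y - y\<^sup>2 / 2 \<le> \<kappa> * y" by linarith
        then have "(\<mu> - A) * y - y\<^sup>2 / 2 \<le> - \<kappa> * \<bar>y\<bar>" using False by (simp add: abs_of_neg)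
        then show "p\<^sub>0 * exp ((\<mu> - A) * y - y\<^sup>2 / 2) \<le> p\<^sub>0 * exp (- \<kappa> * \<bar>y\<bar>)" using p\<^sub>0 by simp
      qed (use m p\<^sub>0 in auto)
      finally show ?thesis by (simp add: mult.assoc)
    qed
    have "2 * \<eta> * \<bar>y\<bar> \<le> \<kappa> / 2 * \<bar>y\<bar>" using \<eta> by (intro mult_right_mono) auto
    then have e: "exp (- \<kappa> * \<bar>y\<bar>) * exp (2 * \<eta> * \<bar>y\<bar>) \<le> exp (- (\<kappa>/2) * \<bar>y\<bar>)"
      by (simp flip: exp_add)
    have "(\<epsilon> * exp (\<eta> * (A + \<eta> / 2)) * normal_density (\<mu> - \<eta>) 1 x - ?p)\<^sup>2 / ?f
        \<le> ?p\<^sup>2 / ?f * (\<eta>\<^sup>2 * y\<^sup>2 * exp (2 * \<eta> * \<bar>y\<bar>))"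
      unfolding y_def using \<epsilon> \<eta> by (intro tilted_gap_integrand) auto
    also have "\<dots> \<le> (2 * m * p\<^sub>0 * exp (- \<kappa> * \<bar>y\<bar>)) * (\<eta>\<^sup>2 * y\<^sup>2 * exp (2 * \<eta> * \<bar>y\<bar>))"
      using p by (intro mult_right_mono) auto
    also have "\<dots> = K * y\<^sup>2 * (exp (- \<kappa> * \<bar>y\<bar>) * exp (2 * \<eta> * \<bar>y\<bar>))"
      by (simp add: K_def mult_ac)
    also have "\<dots> \<le> K * y\<^sup>2 * exp (- (\<kappa>/2) * \<bar>y\<bar>)"
      using e K by (intro mult_left_mono) auto
    finally show "ennreal ((\<epsilon> * exp (\<eta> * (A + \<eta> / 2)) * normal_density (\<mu> - \<eta>) 1 x - ?p)\<^sup>2 / ?f)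
      \<le> ennreal K * ennreal ((x - (\<mu> + A))\<^sup>2 * exp (- (\<kappa>/2) * \<bar>x - (\<mu> + A)\<bar>))"
      unfolding y' using K by (simp flip: ennreal_mult add: ennreal_leI mult.assoc)
  qed
  also have "\<dots> \<le> ennreal K * ennreal (4 / (\<kappa>/2) ^ 3)"
  proof (subst nn_integral_cmult)
    show "ennreal K * (\<integral>\<^sup>+x. ennreal ((x - (\<mu> + A))\<^sup>2 * exp (- (\<kappa>/2) * \<bar>x - (\<mu> + A)\<bar>)) \<partial>lborel)
      \<le> ennreal K * ennreal (4 / (\<kappa>/2) ^ 3)"
      using \<kappa> by (intro mult_left_mono nn_integral_square_exp_abs) auto
  qed measurable
  also have "\<dots> = ennreal (64 * m * (\<epsilon> * normal_density 0 1 A * \<eta>\<^sup>2 / \<kappa> ^ 3))"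
  proof -
    have "4 / (\<kappa>/2) ^ 3 = 32 / \<kappa> ^ 3" by (simp add: power_divide)
    then have "K * (4 / (\<kappa>/2) ^ 3) = 64 * m * (p\<^sub>0 * \<eta>\<^sup>2 / \<kappa> ^ 3)" by (simp add: K_def)
    then show ?thesis unfolding p\<^sub>0_def[symmetric] using K \<kappa> by (subst ennreal_mult[symmetric]) auto
  qed
  finally show ?thesis .
qed

section \<open>From the component gap to the risk\<close>

lemma ln_powr_times_powr_tendsto_0:
  fixes k d :: real
  assumes "0 < d"
  shows "(\<lambda>n::nat. ln (real n) powr k * real n powr (- d)) \<longlonglongrightarrow> 0"
  using assms by real_asymp

text \<open>The perturbed parameters are eventually in the parameter set, and the null component contributes
  only \<open>O(n \<epsilon>\<^sub>0\<^sup>2) = O(n powr (1 - 2 \<beta>))\<close> to \<open>n\<close> times the chi-square distance, which vanishes because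
  \<open>\<beta> > 1/2\<close>. So only the component gap has to be controlled.\<close>

lemma risk_lower_bound_along_sequence:
  fixes v \<eta> :: "nat \<Rightarrow> real"
  assumes \<beta>: "1/2 < \<beta>" and a: "0 < a\<^sub>1" "0 < a\<^sub>2" and b: "0 < b\<^sub>1" "b\<^sub>1 < b\<^sub>2" and \<alpha>: "\<alpha> < 1/2"
    and v_pos: "\<forall>\<^sub>F n in sequentially. 0 < v n" and v_lim: "v \<longlonglongrightarrow> 0"
    and \<eta>_nonneg: "\<forall>\<^sub>F n in sequentially. 0 \<le> \<eta> n" and \<eta>_lim: "(\<lambda>n. \<eta> n * ln (real n)) \<longlonglongrightarrow> 0"
    and gap: "\<forall>\<^sub>F n in sequentially.
      component_gap (b\<^sub>1 * real n powr (- \<beta>)) (sqrt (2 * r * ln (real n)))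
        (b\<^sub>1 * real n powr (- \<beta>) * exp (v n)) (sqrt (2 * r * ln (real n)) - \<eta> n)
      \<le> ennreal (1 / (128 * real n))"
  shows "\<forall>\<^sub>F n in sequentially.
    minimax_risk n (Omega r \<beta> a\<^sub>1 a\<^sub>2 b\<^sub>1 b\<^sub>2 n) \<alpha> \<ge> ennreal (3/32 * v n)"
proof -
  have lim: "(\<lambda>n. b\<^sub>1 * real n powr (- \<beta>)) \<longlonglongrightarrow> 0" "(\<lambda>n. b\<^sub>2 * real n powr (- \<beta>)) \<longlonglongrightarrow> 0"
    "(\<lambda>n. 16 * b\<^sub>1\<^sup>2 * real n powr (1 - 2 * \<beta>)) \<longlonglongrightarrow> 0"
    using \<beta> by real_asymp+
  have "\<forall>\<^sub>F n in sequentially.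
      16 * b\<^sub>1\<^sup>2 * real n powr (1 - 2 * \<beta>) = 16 * (real n * (b\<^sub>1 * real n powr (- \<beta>))\<^sup>2)"
    using eventually_gt_at_top[of 0]
  proof eventually_elim
    case (elim n)
    have "real n powr (1 - 2 * \<beta>) = real n powr (1 + (- \<beta>) + (- \<beta>))" by simp
    also have "\<dots> = real n * (real n powr (- \<beta>))\<^sup>2"
      unfolding powr_add using elim by (simp add: power2_eq_square)
    finally show ?case by (simp add: power_mult_distrib)
  qed
  with lim(3) have lim3: "(\<lambda>n. 16 * (real n * (b\<^sub>1 * real n powr (- \<beta>))\<^sup>2)) \<longlonglongrightarrow> 0"
    by (rule Lim_transform_eventually)
  have "(\<lambda>n. exp (v n)) \<longlonglongrightarrow> exp 0" using v_lim by (intro tendsto_intros)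
  moreover have "exp 0 < b\<^sub>2 / b\<^sub>1" using b by simp
  ultimately have "\<forall>\<^sub>F n in sequentially. exp (v n) < b\<^sub>2 / b\<^sub>1" by (rule order_tendstoD)
  moreover have "\<forall>\<^sub>F n in sequentially. v n < 1" using v_lim by (rule order_tendstoD) simp
  moreover have "\<forall>\<^sub>F n in sequentially. \<eta> n * ln (real n) < a\<^sub>1" using \<eta>_lim a(1) by (rule order_tendstoD)
  moreover have "\<forall>\<^sub>F n in sequentially. b\<^sub>1 * real n powr (- \<beta>) < 1/2"
    using lim(1) by (rule order_tendstoD) simp
  moreover have "\<forall>\<^sub>F n in sequentially. b\<^sub>2 * real n powr (- \<beta>) < 1"
    using lim(2) by (rule order_tendstoD) simp
  moreover have "\<forall>\<^sub>F n in sequentially. 16 * (real n * (b\<^sub>1 * real n powr (- \<beta>))\<^sup>2) < 1/64"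
    using lim3 by (rule order_tendstoD) simp
  moreover have "\<forall>\<^sub>F n in sequentially. 3 \<le> n" by (rule eventually_ge_at_top)
  ultimately show ?thesis using v_pos \<eta>_nonneg gap
  proof eventually_elim
    case (elim n)
    define \<epsilon>\<^sub>0 where "\<epsilon>\<^sub>0 = b\<^sub>1 * real n powr (- \<beta>)"
    define \<epsilon>\<^sub>1 where "\<epsilon>\<^sub>1 = \<epsilon>\<^sub>0 * exp (v n)"
    define \<mu>\<^sub>0 where "\<mu>\<^sub>0 = sqrt (2 * r * ln (real n))"
    have n: "0 < real n" "0 < ln (real n)" using elim(7) by auto
    have \<epsilon>\<^sub>0: "0 < \<epsilon>\<^sub>0" "\<epsilon>\<^sub>0 \<le> 1/2" using b n elim(4) by (simp_all add: \<epsilon>\<^sub>0_def)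
    have \<epsilon>\<^sub>1: "\<epsilon>\<^sub>0 < \<epsilon>\<^sub>1" using \<epsilon>\<^sub>0 elim(8) by (simp add: \<epsilon>\<^sub>1_def)
    have "b\<^sub>1 * exp (v n) \<le> b\<^sub>2" using elim(1) b by (simp add: field_simps)
    then have \<epsilon>\<^sub>1_le: "\<epsilon>\<^sub>1 \<le> b\<^sub>2 * real n powr (- \<beta>)"
      using mult_right_mono[of "b\<^sub>1 * exp (v n)" b\<^sub>2 "real n powr (- \<beta>)"]
      by (simp add: \<epsilon>\<^sub>1_def \<epsilon>\<^sub>0_def mult_ac)
    have \<eta>_le: "\<eta> n \<le> a\<^sub>1 / ln (real n)" using elim(3) n by (simp add: field_simps)
    have margin: "0 \<le> a\<^sub>1 / ln (real n)" "0 \<le> a\<^sub>2 / ln (real n)" using a n by auto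
    have \<Omega>: "(\<epsilon>\<^sub>0, \<mu>\<^sub>0) \<in> Omega r \<beta> a\<^sub>1 a\<^sub>2 b\<^sub>1 b\<^sub>2 n" "(\<epsilon>\<^sub>1, \<mu>\<^sub>0 - \<eta> n) \<in> Omega r \<beta> a\<^sub>1 a\<^sub>2 b\<^sub>1 b\<^sub>2 n"
      using \<epsilon>\<^sub>1 \<epsilon>\<^sub>1_le \<eta>_le margin elim(9) unfolding Omega_def \<mu>\<^sub>0_def by (auto simp: \<epsilon>\<^sub>0_def)
    have "exp (v n) - 1 \<le> 2"
      using exp_bound[of "v n"] power_le_one[of "v n" 2] elim(2,8) by simp
    then have "\<epsilon>\<^sub>1 - \<epsilon>\<^sub>0 \<le> 2 * \<epsilon>\<^sub>0"
      using \<epsilon>\<^sub>0 mult_left_mono[of "exp (v n) - 1" 2 \<epsilon>\<^sub>0] by (simp add: \<epsilon>\<^sub>1_def algebra_simps)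
    then have "(\<epsilon>\<^sub>1 - \<epsilon>\<^sub>0)\<^sup>2 \<le> (2 * \<epsilon>\<^sub>0)\<^sup>2" using \<epsilon>\<^sub>1 by (intro power_mono) auto
    then have "real n * (4 * (\<epsilon>\<^sub>1 - \<epsilon>\<^sub>0)\<^sup>2) \<le> real n * (4 * (2 * \<epsilon>\<^sub>0)\<^sup>2)" by (intro mult_left_mono) auto
    also have "\<dots> \<le> 1/64" using elim(6) by (simp add: \<epsilon>\<^sub>0_def power_mult_distrib)
    finally have mass: "real n * (4 * (\<epsilon>\<^sub>1 - \<epsilon>\<^sub>0)\<^sup>2) \<le> 1/64" .
    \<comment> \<open>The budget \<open>1/32\<close> for \<open>n s\<close> is shared equally by the components and the null part.\<close>
    define s where "s = 1 / (64 * real n) + 4 * (\<epsilon>\<^sub>1 - \<epsilon>\<^sub>0)\<^sup>2"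
    have "chi_square \<epsilon>\<^sub>0 \<mu>\<^sub>0 \<epsilon>\<^sub>1 (\<mu>\<^sub>0 - \<eta> n)
        \<le> 2 * component_gap \<epsilon>\<^sub>0 \<mu>\<^sub>0 \<epsilon>\<^sub>1 (\<mu>\<^sub>0 - \<eta> n) + ennreal (4 * (\<epsilon>\<^sub>1 - \<epsilon>\<^sub>0)\<^sup>2)"
      using \<epsilon>\<^sub>0 by (rule chi_square_le_component_gap)
    also have "\<dots> \<le> 2 * ennreal (1 / (128 * real n)) + ennreal (4 * (\<epsilon>\<^sub>1 - \<epsilon>\<^sub>0)\<^sup>2)"
      using elim(10) unfolding \<epsilon>\<^sub>1_def \<epsilon>\<^sub>0_def \<mu>\<^sub>0_def by (intro add_right_mono mult_left_mono) auto
    also have "2 * ennreal (1 / (128 * real n)) = ennreal (1 / (64 * real n))"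
    proof -
      have "2 * ennreal (1 / (128 * real n)) = ennreal (2 * (1 / (128 * real n)))"
        using n by (subst ennreal_mult) auto
      then show ?thesis by simp
    qed
    also have "ennreal (1 / (64 * real n)) + ennreal (4 * (\<epsilon>\<^sub>1 - \<epsilon>\<^sub>0)\<^sup>2) = ennreal s"
      unfolding s_def using n by (intro ennreal_plus[symmetric]) auto
    finally have chi: "chi_square \<epsilon>\<^sub>0 \<mu>\<^sub>0 \<epsilon>\<^sub>1 (\<mu>\<^sub>0 - \<eta> n) \<le> ennreal s" .
    have s: "0 \<le> s" "real n * s \<le> 1/32"
      using mass n by (auto simp: s_def distrib_left)
    \<comment> \<open>The relative gap is \<open>1 - exp (- v)\<close>, at least \<open>v / 2\<close> for \<open>v \<le> 1\<close>.\<close>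
    have "3/32 * v n \<le> 3/16 * (1 - \<epsilon>\<^sub>0 / \<epsilon>\<^sub>1)"
    proof -
      have "0 \<le> v n * (1 - v n)" using elim(2,8) by simp
      then have "1 \<le> (1 - v n / 2) * (1 + v n)" by (simp add: field_simps)
      also have "\<dots> \<le> (1 - v n / 2) * exp (v n)"
        using elim(2) by (intro mult_left_mono exp_ge_add_one_self) auto
      finally have "exp (- v n) \<le> 1 - v n / 2" by (simp add: exp_minus field_simps)
      moreover have "\<epsilon>\<^sub>0 / \<epsilon>\<^sub>1 = exp (- v n)" using \<epsilon>\<^sub>0 by (simp add: \<epsilon>\<^sub>1_def exp_minus field_simps)
      ultimately show ?thesis by simp
    qed
    then have "ennreal (3/32 * v n) \<le> ennreal (3/16 * (1 - \<epsilon>\<^sub>0 / \<epsilon>\<^sub>1))" by (rule ennreal_leI)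
    also have "\<dots> \<le> minimax_risk n (Omega r \<beta> a\<^sub>1 a\<^sub>2 b\<^sub>1 b\<^sub>2 n) \<alpha>"
      using \<alpha> \<epsilon>\<^sub>0(1) \<epsilon>\<^sub>1 _ \<Omega> chi s
      by (rule minimax_risk_two_points) (use \<epsilon>\<^sub>1_le elim(5) in linarith)
    finally show ?case .
  qed
qed

text \<open>The tilt with offset \<open>A = g sqrt (log n)\<close> has \<open>v \<ge> \<eta> A\<close>, which is where the extra power \<open>1/2\<close> of
  \<open>log n\<close> comes from.\<close>

lemma risk_lower_bound_tilted:
  assumes \<beta>: "1/2 < \<beta>" and a: "0 < a\<^sub>1" "0 < a\<^sub>2" and b: "0 < b\<^sub>1" "b\<^sub>1 < b\<^sub>2" and \<alpha>: "\<alpha> < 1/2"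
    and c: "0 < c" and g: "0 < g" and d: "0 < d"
    and gap: "\<forall>\<^sub>F n in sequentially.
      (let \<epsilon> = b\<^sub>1 * real n powr (- \<beta>); \<mu> = sqrt (2 * r * ln (real n));
           A = g * sqrt (ln (real n)); \<eta> = c * (ln (real n) powr k * real n powr (- d))
       in component_gap \<epsilon> \<mu> (\<epsilon> * exp (\<eta> * (A + \<eta> / 2))) (\<mu> - \<eta>) \<le> ennreal (1 / (128 * real n)))"
  shows "\<exists>C>0. \<forall>\<^sub>F n in sequentially. minimax_risk n (Omega r \<beta> a\<^sub>1 a\<^sub>2 b\<^sub>1 b\<^sub>2 n) \<alpha>
    \<ge> ennreal (C * (ln (real n) powr (k + 1/2) * real n powr (- d)))"
proof -
  define \<eta> where "\<eta> = (\<lambda>n. c * (ln (real n) powr k * real n powr (- d)))"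
  define v where "v = (\<lambda>n. \<eta> n * (g * sqrt (ln (real n)) + \<eta> n / 2))"
  have large: "\<forall>\<^sub>F n::nat in sequentially. 3 \<le> n" by (rule eventually_ge_at_top)
  have \<eta>: "\<forall>\<^sub>F n in sequentially. 0 < \<eta> n"
    using large by eventually_elim (simp add: \<eta>_def c)
  have \<eta>_lim: "\<eta> \<longlonglongrightarrow> 0" unfolding \<eta>_def
    using tendsto_mult_left[OF ln_powr_times_powr_tendsto_0[OF d, of k], of c] by simp
  have "(\<lambda>n. c * (ln (real n) powr (k + 1) * real n powr (- d))) \<longlonglongrightarrow> 0"
    using tendsto_mult_left[OF ln_powr_times_powr_tendsto_0[OF d, of "k + 1"], of c] by simp
  then have \<eta>_ln: "(\<lambda>n. \<eta> n * ln (real n)) \<longlonglongrightarrow> 0"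
    by (rule Lim_transform_eventually)
      (use large in eventually_elim, auto simp: \<eta>_def powr_add)
  have main: "(\<lambda>n. c * g * (ln (real n) powr (k + 1/2) * real n powr (- d))) \<longlonglongrightarrow> 0"
    using tendsto_mult_left[OF ln_powr_times_powr_tendsto_0[OF d, of "k + 1/2"], of "c * g"] by simp
  have v_eq: "\<forall>\<^sub>F n in sequentially.
      c * g * (ln (real n) powr (k + 1/2) * real n powr (- d)) + \<eta> n * \<eta> n / 2 = v n"
    using large
  proof eventually_elim
    case (elim n)
    then have "ln (real n) powr (k + 1/2) = ln (real n) powr k * sqrt (ln (real n))"
      by (simp add: powr_add powr_half_sqrt)
    then have "c * g * (ln (real n) powr (k + 1/2) * real n powr (- d)) = \<eta> n * (g * sqrt (ln (real n)))"
      by (simp add: \<eta>_def)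
    then show ?case by (simp add: v_def distrib_left)
  qed
  have "(\<lambda>n. c * g * (ln (real n) powr (k + 1/2) * real n powr (- d)) + \<eta> n * \<eta> n / 2) \<longlonglongrightarrow> 0 + 0 * 0 / 2"
    by (intro tendsto_add tendsto_divide tendsto_mult main \<eta>_lim tendsto_const) auto
  then have v_lim: "v \<longlonglongrightarrow> 0"
    using v_eq by (simp add: Lim_transform_eventually)
  have v_pos: "\<forall>\<^sub>F n in sequentially. 0 < v n"
    using \<eta> large
  proof eventually_elim
    case (elim n)
    have "0 \<le> g * sqrt (ln (real n))" using g elim(2) by simp
    then show ?case unfolding v_def using elim(1) by (intro mult_pos_pos add_nonneg_pos) auto
  qed
  have "\<forall>\<^sub>F n in sequentially.
    minimax_risk n (Omega r \<beta> a\<^sub>1 a\<^sub>2 b\<^sub>1 b\<^sub>2 n) \<alpha> \<ge> ennreal (3/32 * v n)"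
  proof (rule risk_lower_bound_along_sequence[OF \<beta> a b \<alpha> v_pos v_lim _ \<eta>_ln])
    show "\<forall>\<^sub>F n in sequentially. 0 \<le> \<eta> n" using \<eta> by eventually_elim simp
  qed (use gap in \<open>simp add: Let_def v_def \<eta>_def\<close>)
  then have "\<forall>\<^sub>F n in sequentially. minimax_risk n (Omega r \<beta> a\<^sub>1 a\<^sub>2 b\<^sub>1 b\<^sub>2 n) \<alpha>
    \<ge> ennreal (3/32 * (c * g) * (ln (real n) powr (k + 1/2) * real n powr (- d)))"
    using v_eq
  proof eventually_elim
    case (elim n)
    have "3/32 * (c * g) * (ln (real n) powr (k + 1/2) * real n powr (- d)) \<le> 3/32 * v n"
      unfolding elim(2)[symmetric] by (simp add: mult.assoc)
    then show ?case using elim(1) by (meson ennreal_leI order_trans)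
  qed
  moreover have "0 < 3/32 * (c * g)" using c g by simp
  ultimately show ?thesis by blast
qed

section \<open>The three regimes\<close>

text \<open>Here \<open>\<epsilon>\<^sup>2 exp (\<mu>\<^sup>2) = b\<^sub>1\<^sup>2 n powr (2 r - 2 \<beta>)\<close>, so \<open>\<eta>\<^sup>2\<close> of order \<open>n powr (2 \<beta> - 2 r - 1)\<close> brings the
  component gap down to order \<open>1 / n\<close>.\<close>

lemma risk_lower_bound_small_shift:
  assumes r: "0 < r" and \<beta>: "1/2 < \<beta>" and a: "0 < a\<^sub>1" "0 < a\<^sub>2" and b: "0 < b\<^sub>1" "b\<^sub>1 < b\<^sub>2"
    and \<alpha>: "\<alpha> < 1/2" and boundary: "\<beta> - 1/2 < r"
  shows "\<exists>C>0. \<forall>\<^sub>F n in sequentially. minimax_risk n (Omega r \<beta> a\<^sub>1 a\<^sub>2 b\<^sub>1 b\<^sub>2 n) \<alpha>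
    \<ge> ennreal (C * (ln (real n) powr (1/2) * real n powr (- 1/2 - r + \<beta>)))"
proof -
  \<comment> \<open>This constant makes the bound on the component gap exactly \<open>1 / (128 n)\<close>.\<close>
  define c where "c = 1 / (32 * exp 1 * b\<^sub>1)"
  define d where "d = 1/2 + r - \<beta>"
  have c: "0 < c" using b by (simp add: c_def)
  have d: "0 < d" using boundary by (simp add: d_def)
  have g: "0 < sqrt (2 * r)" using r by simp
  have "(\<lambda>n. c * (ln (real n) powr 0 * real n powr (- d))) \<longlonglongrightarrow> 0"
    using tendsto_mult_left[OF ln_powr_times_powr_tendsto_0[OF d, of 0], of c] by simp
  then have "\<forall>\<^sub>F n in sequentially. c * (ln (real n) powr 0 * real n powr (- d)) < 1/2"
    by (rule order_tendstoD) simp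
  moreover have "(\<lambda>n. b\<^sub>1 * real n powr (- \<beta>)) \<longlonglongrightarrow> 0" using \<beta> by real_asymp
  then have "\<forall>\<^sub>F n in sequentially. b\<^sub>1 * real n powr (- \<beta>) < 1/2"
    by (rule order_tendstoD) simp
  moreover have "\<forall>\<^sub>F n::nat in sequentially. 3 \<le> n" by (rule eventually_ge_at_top)
  ultimately have "\<forall>\<^sub>F n in sequentially.
      (let \<epsilon> = b\<^sub>1 * real n powr (- \<beta>); \<mu> = sqrt (2 * r * ln (real n));
           A = sqrt (2 * r) * sqrt (ln (real n)); \<eta> = c * (ln (real n) powr 0 * real n powr (- d))
       in component_gap \<epsilon> \<mu> (\<epsilon> * exp (\<eta> * (A + \<eta> / 2))) (\<mu> - \<eta>) \<le> ennreal (1 / (128 * real n)))"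
  proof eventually_elim
    case (elim n)
    define \<epsilon> where "\<epsilon> = b\<^sub>1 * real n powr (- \<beta>)"
    define \<mu> where "\<mu> = sqrt (2 * r * ln (real n))"
    define \<eta> where "\<eta> = c * (ln (real n) powr 0 * real n powr (- d))"
    have n: "0 < real n" "0 < ln (real n)" using elim(3) by auto
    have \<eta>_eq: "\<eta> = c * real n powr (- d)" using n by (simp add: \<eta>_def)
    have A: "sqrt (2 * r) * sqrt (ln (real n)) = \<mu>" by (simp add: \<mu>_def real_sqrt_mult)
    have "component_gap \<epsilon> \<mu> (\<epsilon> * exp (\<eta> * (\<mu> + \<eta> / 2))) (\<mu> - \<eta>)
      \<le> ennreal (8 * exp 2 * (\<epsilon>\<^sup>2 * exp (\<mu>\<^sup>2) * \<eta>\<^sup>2))"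
    proof (rule component_gap_crossing_at_twice_mean)
      show "0 \<le> \<eta>" using c by (simp add: \<eta>_eq)
    qed (use elim b n in \<open>auto simp: \<epsilon>_def \<eta>_def\<close>)
    also have "8 * exp 2 * (\<epsilon>\<^sup>2 * exp (\<mu>\<^sup>2) * \<eta>\<^sup>2) = 1 / (128 * real n)"
    proof -
      have "\<mu>\<^sup>2 = 2 * r * ln (real n)" using r n by (simp add: \<mu>_def)
      then have "exp (\<mu>\<^sup>2) = real n powr (2 * r)" using n by (simp add: powr_def)
      moreover have "(real n powr x)\<^sup>2 = real n powr (2 * x)" for x
        by (simp add: powr_add[symmetric] power2_eq_square)
      ultimately have "\<epsilon>\<^sup>2 * exp (\<mu>\<^sup>2) * \<eta>\<^sup>2
          = b\<^sub>1\<^sup>2 * c\<^sup>2 * (real n powr (2 * - \<beta>) * real n powr (2 * r) * real n powr (2 * - d))"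
        by (simp add: \<epsilon>_def \<eta>_eq power_mult_distrib)
      also have "real n powr (2 * - \<beta>) * real n powr (2 * r) * real n powr (2 * - d) = real n powr (- 1)"
        unfolding powr_add[symmetric] by (rule arg_cong[where f = "(powr) (real n)"]) (simp add: d_def)
      also have "real n powr (- 1) = 1 / real n" using n by (simp add: powr_minus_divide)
      finally have "\<epsilon>\<^sup>2 * exp (\<mu>\<^sup>2) * \<eta>\<^sup>2 = b\<^sub>1\<^sup>2 * c\<^sup>2 * (1 / real n)" .
      moreover have "8 * exp 2 * (b\<^sub>1\<^sup>2 * c\<^sup>2) = 1/128"
      proof -
        have "exp (2::real) = (exp 1)\<^sup>2" by (simp flip: exp_double)
        then show ?thesis using b by (simp add: c_def power_divide power_mult_distrib)
      qed
      ultimately have "8 * exp 2 * (\<epsilon>\<^sup>2 * exp (\<mu>\<^sup>2) * \<eta>\<^sup>2) = 1/128 * (1 / real n)"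
        by (simp only: mult.assoc[symmetric])
      then show ?thesis by simp
    qed
    finally show ?case unfolding Let_def A \<epsilon>_def[symmetric] \<mu>_def[symmetric] \<eta>_def[symmetric] .
  qed
  note bound = risk_lower_bound_tilted[OF \<beta> a b \<alpha> c g d this]
  have exponent_eq: "- 1/2 - r + \<beta> = - d" by (simp add: d_def)
  show ?thesis unfolding exponent_eq using bound by simp
qed

text \<open>The offset \<open>A = g sqrt (log n)\<close> puts the crossing at the dominance point: \<open>((\<mu> + A)\<^sup>2 - A\<^sup>2) / 2\<close> equals
  \<open>\<beta> log n\<close>. The component has height of order \<open>n powr (- (\<beta> + r)\<^sup>2 / (4 r))\<close> there, and
  \<open>\<eta>\<^sup>2 / \<kappa>\<^sup>3\<close> times this height is of order \<open>1 / n\<close> for \<open>\<eta>\<close> of order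
  \<open>(log n) powr (3/4) * n powr (- d)\<close>.\<close>

lemma risk_lower_bound_intermediate_shift:
  assumes r: "0 < r" and \<beta>: "1/2 < \<beta>" and a: "0 < a\<^sub>1" "0 < a\<^sub>2" and b: "0 < b\<^sub>1" "b\<^sub>1 < b\<^sub>2"
    and \<alpha>: "\<alpha> < 1/2" and range: "r < \<beta>" "\<beta> < 3 * r" and boundary: "(\<beta> + r)\<^sup>2 < 4 * r"
  shows "\<exists>C>0. \<forall>\<^sub>F n in sequentially. minimax_risk n (Omega r \<beta> a\<^sub>1 a\<^sub>2 b\<^sub>1 b\<^sub>2 n) \<alpha>
    \<ge> ennreal (C * (ln (real n) powr (5/4) * real n powr (- 1/2 + (\<beta> + r)\<^sup>2 / (8 * r))))"
proof -
  \<comment> \<open>At the crossing the component is \<open>b\<^sub>1\<close> times the null density.\<close>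
  define m where "m = max 1 b\<^sub>1"
  define g where "g = (\<beta> - r) / sqrt (2 * r)"
  \<comment> \<open>The smaller of the two decay rates \<open>A\<close> and \<open>\<mu> - A\<close>, in units of \<open>sqrt (log n)\<close>.\<close>
  define \<kappa>\<^sub>0 where "\<kappa>\<^sub>0 = min (\<beta> - r) (3 * r - \<beta>) / sqrt (2 * r)"
  \<comment> \<open>With \<open>8192 = 64 * 128\<close>, the bound \<open>64 m b\<^sub>1 c\<^sup>2 / \<kappa>\<^sub>0\<^sup>3\<close> is \<open>1/128\<close>.\<close>
  define c where "c = sqrt (\<kappa>\<^sub>0 ^ 3 / (8192 * m * b\<^sub>1))"
  define d where "d = 1/2 - (\<beta> + r)\<^sup>2 / (8 * r)"
  have m: "1 \<le> m" "b\<^sub>1 \<le> m" by (auto simp: m_def)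
  have g: "0 < g" and \<kappa>\<^sub>0: "0 < \<kappa>\<^sub>0" using range r by (auto simp: g_def \<kappa>\<^sub>0_def)
  have c: "0 < c" using \<kappa>\<^sub>0 m b by (simp add: c_def)
  have d: "0 < d" using boundary r by (simp add: d_def field_simps)
  have root: "sqrt (2 * r) * sqrt (2 * r) = 2 * r" "0 < sqrt (2 * r)" using r by auto
  have \<kappa>\<^sub>0_le: "\<kappa>\<^sub>0 \<le> g" "\<kappa>\<^sub>0 \<le> sqrt (2 * r) - g"
  proof -
    show "\<kappa>\<^sub>0 \<le> g" unfolding \<kappa>\<^sub>0_def g_def using root by (intro divide_right_mono) auto
    have "sqrt (2 * r) - g = (sqrt (2 * r) * sqrt (2 * r) - (\<beta> - r)) / sqrt (2 * r)"
      unfolding g_def diff_divide_distrib using root(2)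
      by (metis less_irrefl nonzero_mult_div_cancel_right)
    also have "\<dots> = (3 * r - \<beta>) / sqrt (2 * r)" unfolding root by simp
    finally show "\<kappa>\<^sub>0 \<le> sqrt (2 * r) - g"
      unfolding \<kappa>\<^sub>0_def using root by (simp add: divide_right_mono)
  qed
  have g2: "g\<^sup>2 / 2 = (\<beta> - r)\<^sup>2 / (4 * r)" using r by (simp add: g_def power_divide)
  have "(sqrt (2 * r) + g)\<^sup>2 = 2 * r + g\<^sup>2 + 2 * (\<beta> - r)"
    using r by (simp add: power2_sum g_def)
  then have rg: "(sqrt (2 * r) + g)\<^sup>2 / 2 = \<beta> + g\<^sup>2 / 2" by simp
  have exponent: "\<beta> + g\<^sup>2 / 2 = 2 * (1/2 - d)"
    unfolding g2 using r by (simp add: d_def power2_eq_square field_simps)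
  have "(\<lambda>n. c * (ln (real n) powr (3/4) * real n powr (- d))) \<longlonglongrightarrow> 0"
    using tendsto_mult_left[OF ln_powr_times_powr_tendsto_0[OF d, of "3/4"], of c] by simp
  then have "\<forall>\<^sub>F n in sequentially. c * (ln (real n) powr (3/4) * real n powr (- d)) < \<kappa>\<^sub>0 / 4"
    by (rule order_tendstoD) (use \<kappa>\<^sub>0 in simp)
  moreover have "(\<lambda>n. b\<^sub>1 * real n powr (- \<beta>)) \<longlonglongrightarrow> 0" using \<beta> by real_asymp
  then have "\<forall>\<^sub>F n in sequentially. b\<^sub>1 * real n powr (- \<beta>) < 1/2"
    by (rule order_tendstoD) simp
  moreover have "\<forall>\<^sub>F n::nat in sequentially. 1 \<le> sqrt (ln (real n))" by real_asymp
  ultimately have "\<forall>\<^sub>F n in sequentially.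
      (let \<epsilon> = b\<^sub>1 * real n powr (- \<beta>); \<mu> = sqrt (2 * r * ln (real n));
           A = g * sqrt (ln (real n)); \<eta> = c * (ln (real n) powr (3/4) * real n powr (- d))
       in component_gap \<epsilon> \<mu> (\<epsilon> * exp (\<eta> * (A + \<eta> / 2))) (\<mu> - \<eta>) \<le> ennreal (1 / (128 * real n)))"
  proof eventually_elim
    case (elim n)
    define L where "L = ln (real n)"
    define \<epsilon> where "\<epsilon> = b\<^sub>1 * real n powr (- \<beta>)"
    define \<mu> where "\<mu> = sqrt (2 * r * L)"
    define A where "A = g * sqrt L"
    define \<eta> where "\<eta> = c * (L powr (3/4) * real n powr (- d))"
    define \<kappa> where "\<kappa> = \<kappa>\<^sub>0 * sqrt L"
    have "1 \<le> sqrt L" using elim(3) by (simp add: L_def)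
    moreover from this have "0 < L" using real_sqrt_gt_0_iff[of L] by linarith
    ultimately have L: "0 < L" "1 \<le> sqrt L" by auto
    then have n: "0 < real n" unfolding L_def by (cases "n = 0") auto
    have powr_n: "real n powr x = exp (x * L)" for x using n by (simp add: powr_def L_def)
    have \<mu>_eq: "\<mu> = sqrt (2 * r) * sqrt L" by (simp add: \<mu>_def real_sqrt_mult)
    have sq: "(x * sqrt L)\<^sup>2 / 2 = x\<^sup>2 / 2 * L" for x using L by (simp add: power_mult_distrib)
    have "component_gap \<epsilon> \<mu> (\<epsilon> * exp (\<eta> * (A + \<eta> / 2))) (\<mu> - \<eta>)
      \<le> ennreal (64 * m * (\<epsilon> * normal_density 0 1 A * \<eta>\<^sup>2 / \<kappa> ^ 3))"
    proof (rule component_gap_crossing_at_dominance_point)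
      show "0 < \<kappa>" using \<kappa>\<^sub>0 L by (simp add: \<kappa>_def)
      show "\<kappa> \<le> A" using \<kappa>\<^sub>0_le L by (simp add: \<kappa>_def A_def mult_right_mono)
      have "\<kappa>\<^sub>0 * sqrt L \<le> (sqrt (2 * r) - g) * sqrt L"
        using \<kappa>\<^sub>0_le L by (intro mult_right_mono) auto
      then show "\<kappa> \<le> \<mu> - A" by (simp add: \<kappa>_def A_def \<mu>_eq left_diff_distrib)
      show "0 \<le> \<eta>" using c by (simp add: \<eta>_def)
      have "4 * \<eta> \<le> \<kappa>\<^sub>0 * 1" using elim(1) by (simp add: \<eta>_def L_def)
      also have "\<dots> \<le> \<kappa>" unfolding \<kappa>_def using L \<kappa>\<^sub>0 by (intro mult_left_mono) auto
      finally show "4 * \<eta> \<le> \<kappa>" .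
      have "(\<mu> + A)\<^sup>2 / 2 = \<beta> * L + A\<^sup>2 / 2"
      proof -
        have "\<mu> + A = (sqrt (2 * r) + g) * sqrt L" by (simp add: \<mu>_eq A_def distrib_right)
        then have "(\<mu> + A)\<^sup>2 / 2 = (\<beta> + g\<^sup>2 / 2) * L" by (simp only: sq rg)
        also have "\<dots> = \<beta> * L + A\<^sup>2 / 2" unfolding A_def sq by (rule distrib_right)
        finally show ?thesis .
      qed
      then have "exp (- (\<mu> + A)\<^sup>2 / 2) = real n powr (- \<beta>) * exp (- A\<^sup>2 / 2)"
        unfolding powr_n exp_add[symmetric] by (intro arg_cong[where f = exp]) simp
      then have "normal_density 0 1 (\<mu> + A) = real n powr (- \<beta>) * normal_density 0 1 A"
        by (simp add: normal_density_def)
      then show "\<epsilon> * normal_density 0 1 A \<le> m * normal_density 0 1 (\<mu> + A)"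
        using m mult_right_mono[OF m(2), of "real n powr (- \<beta>) * normal_density 0 1 A"]
        by (simp add: \<epsilon>_def mult.assoc)
    qed (use elim b n m in \<open>auto simp: \<epsilon>_def\<close>)
    also have "64 * m * (\<epsilon> * normal_density 0 1 A * \<eta>\<^sup>2 / \<kappa> ^ 3) \<le> 1 / (128 * real n)"
    proof -
      have "normal_density 0 1 A \<le> exp (- (g\<^sup>2 / 2 * L))"
      proof -
        have "1 / sqrt (2 * pi) \<le> 1" using pi_ge_two by (simp add: divide_le_eq)
        then have "1 / sqrt (2 * pi) * exp (- (A\<^sup>2 / 2)) \<le> 1 * exp (- (A\<^sup>2 / 2))"
          by (intro mult_right_mono) auto
        then show ?thesis unfolding A_def sq[symmetric] by (simp add: std_normal_density_def)
      qed
      then have "\<epsilon> * normal_density 0 1 A \<le> \<epsilon> * exp (- (g\<^sup>2 / 2 * L))"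
        using b by (intro mult_left_mono) (auto simp: \<epsilon>_def)
      also have "\<dots> = b\<^sub>1 * exp (- (2 * (1/2 - d) * L))"
        unfolding exponent[symmetric] \<epsilon>_def powr_n
        by (simp flip: exp_add add: algebra_simps)
      finally have peak: "\<epsilon> * normal_density 0 1 A \<le> b\<^sub>1 * exp (- (2 * (1/2 - d) * L))" .
      have "(L powr (3/4))\<^sup>2 = sqrt L ^ 3"
      proof -
        have "(L powr (3/4))\<^sup>2 = L powr (1/2 + 1/2 + 1/2)"
          by (simp add: power2_eq_square flip: powr_add)
        also have "\<dots> = sqrt L ^ 3" unfolding powr_add using L
          by (simp add: powr_half_sqrt power3_eq_cube)
        finally show ?thesis .
      qed
      then have \<eta>2: "\<eta>\<^sup>2 / \<kappa> ^ 3 = c\<^sup>2 / \<kappa>\<^sub>0 ^ 3 * exp (- (2 * d * L))"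
        using L by (simp add: \<eta>_def \<kappa>_def power_mult_distrib powr_n exp_double[symmetric])
      have "\<epsilon> * normal_density 0 1 A * (\<eta>\<^sup>2 / \<kappa> ^ 3)
          \<le> b\<^sub>1 * exp (- (2 * (1/2 - d) * L)) * (\<eta>\<^sup>2 / \<kappa> ^ 3)"
        using peak L \<kappa>\<^sub>0 by (intro mult_right_mono) (auto simp: \<kappa>_def)
      also have "\<dots> = b\<^sub>1 * (c\<^sup>2 / \<kappa>\<^sub>0 ^ 3) * exp (- L)"
        unfolding \<eta>2 by (simp add: algebra_simps flip: exp_add)
      also have "exp (- L) = 1 / real n" using n by (simp add: L_def exp_minus field_simps)
      also have "c\<^sup>2 / \<kappa>\<^sub>0 ^ 3 = 1 / (8192 * m * b\<^sub>1)"
        using \<kappa>\<^sub>0 m b by (simp add: c_def)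
      finally have "\<epsilon> * normal_density 0 1 A * (\<eta>\<^sup>2 / \<kappa> ^ 3) \<le> 1 / (8192 * m) * (1 / real n)"
        using b by simp
      then have "64 * m * (\<epsilon> * normal_density 0 1 A * (\<eta>\<^sup>2 / \<kappa> ^ 3))
          \<le> 64 * m * (1 / (8192 * m) * (1 / real n))"
        using m by (intro mult_left_mono) auto
      then show ?thesis using m by simp
    qed
    finally show ?case
      unfolding Let_def L_def[symmetric] \<epsilon>_def[symmetric] \<mu>_def[symmetric] A_def[symmetric] \<eta>_def[symmetric]
      by (simp add: ennreal_leI)
  qed
  note bound = risk_lower_bound_tilted[OF \<beta> a b \<alpha> c g d this]
  have exponent_eq: "- 1/2 + (\<beta> + r)\<^sup>2 / (8 * r) = - d" by (simp add: d_def)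
  show ?thesis unfolding exponent_eq using bound by simp
qed

text \<open>With a common mean the component gap is at most \<open>\<epsilon> (exp v - 1)\<^sup>2\<close>, hence of order \<open>n powr (- \<beta>) v\<^sup>2\<close>.\<close>

lemma risk_lower_bound_large_shift:
  assumes \<beta>: "1/2 < \<beta>" "\<beta> < 1" and a: "0 < a\<^sub>1" "0 < a\<^sub>2" and b: "0 < b\<^sub>1" "b\<^sub>1 < b\<^sub>2"
    and \<alpha>: "\<alpha> < 1/2"
  shows "\<exists>C>0. \<forall>\<^sub>F n in sequentially. minimax_risk n (Omega r \<beta> a\<^sub>1 a\<^sub>2 b\<^sub>1 b\<^sub>2 n) \<alpha>
    \<ge> ennreal (C * real n powr (- 1/2 + \<beta> / 2))"
proof -
  define c where "c = 1 / sqrt (512 * b\<^sub>1)"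
  define v where "v = (\<lambda>n. c * real n powr (- 1/2 + \<beta> / 2))"
  have c: "0 < c" using b by (simp add: c_def)
  have "(\<lambda>n::nat. real n powr (- 1/2 + \<beta> / 2)) \<longlonglongrightarrow> 0" using \<beta> by real_asymp
  from tendsto_mult_left[OF this, of c] have v_lim: "v \<longlonglongrightarrow> 0" by (simp add: v_def)
  have large: "\<forall>\<^sub>F n::nat in sequentially. 3 \<le> n" by (rule eventually_ge_at_top)
  have v_pos: "\<forall>\<^sub>F n in sequentially. 0 < v n"
    using large by eventually_elim (simp add: v_def c)
  have "(\<lambda>n. b\<^sub>1 * real n powr (- \<beta>)) \<longlonglongrightarrow> 0" using \<beta> by real_asymp
  then have "\<forall>\<^sub>F n in sequentially. b\<^sub>1 * real n powr (- \<beta>) < 1"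
    by (rule order_tendstoD) simp
  moreover have "\<forall>\<^sub>F n in sequentially. v n < 1" using v_lim by (rule order_tendstoD) simp
  ultimately have "\<forall>\<^sub>F n in sequentially.
      component_gap (b\<^sub>1 * real n powr (- \<beta>)) (sqrt (2 * r * ln (real n)))
        (b\<^sub>1 * real n powr (- \<beta>) * exp (v n)) (sqrt (2 * r * ln (real n)) - 0)
      \<le> ennreal (1 / (128 * real n))"
    using v_pos large
  proof eventually_elim
    case (elim n)
    define \<epsilon> where "\<epsilon> = b\<^sub>1 * real n powr (- \<beta>)"
    have n: "0 < real n" using elim by simp
    have \<epsilon>: "0 < \<epsilon>" "\<epsilon> \<le> 1" using b n elim(1) by (auto simp: \<epsilon>_def)
    have "(v n)\<^sup>2 \<le> v n" using elim by (simp add: power2_eq_square mult_left_le)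
    then have "exp (v n) - 1 \<le> 2 * v n" using exp_bound[of "v n"] elim by simp
    then have "(exp (v n) - 1)\<^sup>2 \<le> (2 * v n)\<^sup>2" using elim by (intro power_mono) auto
    then have "\<epsilon> * (exp (v n) - 1)\<^sup>2 \<le> \<epsilon> * (2 * v n)\<^sup>2" using \<epsilon> by (intro mult_left_mono) auto
    also have "\<dots> = 4 * c\<^sup>2 * b\<^sub>1 * (real n powr (- \<beta>) * (real n powr (- 1/2 + \<beta> / 2))\<^sup>2)"
      by (simp add: \<epsilon>_def v_def power_mult_distrib)
    also have "real n powr (- \<beta>) * (real n powr (- 1/2 + \<beta> / 2))\<^sup>2 = real n powr (- 1)"
      unfolding power2_eq_square powr_add[symmetric] by simp
    also have "real n powr (- 1) = 1 / real n" using n by (simp add: powr_minus_divide)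
    also have "4 * c\<^sup>2 * b\<^sub>1 = 1/128" using b by (simp add: c_def power_divide)
    finally have "\<epsilon> * (exp (v n) - 1)\<^sup>2 \<le> 1 / (128 * real n)" by simp
    moreover have "(\<epsilon> * exp (v n) - \<epsilon>)\<^sup>2 / \<epsilon> = \<epsilon> * (exp (v n) - 1)\<^sup>2"
    proof -
      have "\<epsilon> * exp (v n) - \<epsilon> = \<epsilon> * (exp (v n) - 1)" by (simp add: algebra_simps)
      then show ?thesis using \<epsilon> by (simp add: power_mult_distrib power2_eq_square)
    qed
    ultimately have "ennreal ((\<epsilon> * exp (v n) - \<epsilon>)\<^sup>2 / \<epsilon>) \<le> ennreal (1 / (128 * real n))"
      by (simp add: ennreal_leI)
    then show ?case using component_gap_equal_means[OF \<epsilon>] unfolding \<epsilon>_def[symmetric] diff_zero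
      by (rule order_trans[rotated])
  qed
  from risk_lower_bound_along_sequence[OF \<beta>(1) a b \<alpha> v_pos v_lim _ _ this]
  have "\<forall>\<^sub>F n in sequentially. minimax_risk n (Omega r \<beta> a\<^sub>1 a\<^sub>2 b\<^sub>1 b\<^sub>2 n) \<alpha>
    \<ge> ennreal (3/32 * c * real n powr (- 1/2 + \<beta> / 2))"
    by (simp add: v_def mult.assoc)
  moreover have "0 < 3/32 * c" using c by simp
  ultimately show ?thesis by blast
qed

text \<open>In terms of \<open>u = sqrt (1 - \<beta>)\<close>, the inequality \<open>(\<beta> + r)\<^sup>2 < 4 r\<close> amounts to \<open>r > (1 - u)\<^sup>2\<close>, the second
  branch of the boundary. The two branches meet at \<open>\<beta> = 3/4\<close>, that is \<open>u = 1/2\<close>, where both equal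
  \<open>\<beta> / 3\<close>. Away from it, \<open>(1 - u)\<^sup>2\<close> is below \<open>\<beta> / 3\<close> for \<open>\<beta> < 3/4\<close> and above it for \<open>\<beta> > 3/4\<close>; so
  the condition \<open>3 r \<le> \<beta>\<close> forces the first branch, and for \<open>\<beta> < 3 r\<close> the second inequality holds on
  both branches.\<close>

lemma rate_exponent_negative:
  assumes "0 < r" "1/2 < \<beta>" "\<beta> < 1" and "detection_boundary \<beta> < r"
  shows "3 * r \<le> \<beta> \<Longrightarrow> \<beta> - 1/2 < r"
    and "r < \<beta> \<Longrightarrow> \<beta> < 3 * r \<Longrightarrow> (\<beta> + r)\<^sup>2 < 4 * r"
proof -
  define u where "u = sqrt (1 - \<beta>)"
  have u: "0 < u" "u < 1" "\<beta> = 1 - u\<^sup>2" using assms by (auto simp: u_def)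
  show "\<beta> - 1/2 < r" if "3 * r \<le> \<beta>"
  proof (cases "\<beta> \<le> 3/4")
    case False
    then have "u < 1/2" unfolding u_def by (intro real_less_lsqrt) (auto simp: power_divide)
    have "0 \<le> (1 - u) * (2 - 4 * u)" using u \<open>u < 1/2\<close> by (intro mult_nonneg_nonneg) auto
    then have "\<beta> \<le> 3 * (1 - u)\<^sup>2" unfolding u(3) by (simp add: power2_eq_square algebra_simps)
    then show ?thesis using assms False that by (simp add: detection_boundary_def u_def)
  qed (use assms in \<open>simp add: detection_boundary_def\<close>)
  show "(\<beta> + r)\<^sup>2 < 4 * r" if "r < \<beta>" "\<beta> < 3 * r"
  proof -
    have "(1 - u)\<^sup>2 < r"
    proof (cases "\<beta> \<le> 3/4")
      case True
      then have "1/2 \<le> u" unfolding u_def by (intro real_le_rsqrt) (auto simp: power_divide)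
      then have "0 \<le> (1 - u) * (4 * u - 2)" using u by (intro mult_nonneg_nonneg) auto
      then have "3 * (1 - u)\<^sup>2 \<le> \<beta>" unfolding u(3) by (simp add: power2_eq_square algebra_simps)
      then show ?thesis using that by simp
    qed (use assms in \<open>simp add: detection_boundary_def u_def\<close>)
    then have "1 - u < sqrt r" by (rule real_less_rsqrt)
    moreover have "sqrt r < 1" using that assms by (simp add: real_sqrt_lt_1_iff)
    ultimately have "(1 - sqrt r)\<^sup>2 < u\<^sup>2" by (intro power_strict_mono) auto
    then have "\<beta> + r < 2 * sqrt r" using u(3) assms by (simp add: power2_diff)
    then have "(\<beta> + r)\<^sup>2 < (2 * sqrt r)\<^sup>2" using assms by (intro power_strict_mono) auto
    then show ?thesis using assms by (simp add: power_mult_distrib)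
  qed
qed

theorem theorem5p2:
  fixes r \<beta> a\<^sub>1 a\<^sub>2 b\<^sub>1 b\<^sub>2 \<alpha> :: real
  assumes "0 < r" and "r < 1"
    and "1/2 < \<beta>" and "\<beta> < 1"
    and "detection_boundary \<beta> < r"
    and "0 < a\<^sub>1" and "0 < a\<^sub>2"
    and "0 < b\<^sub>1" and "b\<^sub>1 < b\<^sub>2"
    and "0 < \<alpha>" and "\<alpha> < 1/2"
  shows "\<exists>C>0. \<forall>\<^sub>F n in sequentially.
           minimax_risk n (Omega r \<beta> a\<^sub>1 a\<^sub>2 b\<^sub>1 b\<^sub>2 n) \<alpha> \<ge> ennreal (C * rate r \<beta> n)"
proof -
  note boundary = rate_exponent_negative[OF assms(1,3,4,5)]
  consider "3 * r \<le> \<beta>" | "r < \<beta>" "\<beta> < 3 * r" | "\<beta> \<le> r" by linarith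
  then show ?thesis
  proof cases
    case 1
    then show ?thesis
      using risk_lower_bound_small_shift[OF assms(1,3,6-9,11) boundary(1)] by (simp add: rate_def)
  next
    case 2
    then show ?thesis
      using risk_lower_bound_intermediate_shift[OF assms(1,3,6-9,11) _ _ boundary(2)] by (simp add: rate_def)
  next
    case 3
    then have "\<not> 3 * r \<le> \<beta>" "\<not> r < \<beta>" using assms(1) by auto
    then show ?thesis
      using risk_lower_bound_large_shift[OF assms(3,4,6-9,11)] by (simp add: rate_def)
  qed
qed

end
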